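(* Let $\mathbb{E}: K\xrightarrow{k}X\xrightarrow{f}M$ be a Schreier extension of monoids with $K$ commutative and cancellative, and let $K\xrightarrow{\overline{\kappa}}df\xrightarrow{\overline{f}}M$, with section $\overline{s}\colon M\to df$, be the associated Schreier point (see context). Then the Schreier extension $\overline{\mathbb{E}}: K\xrightarrow{\overline{\kappa}}df\xrightarrow{\overline{f}}M$ has an internal commutative monoid structure in $cc\text{-}SExt_M$, whose unit is the morphism $\overline{s}\colon\mathds{1}\to\overline{\mathbb{E}}$ and whose multiplication is the morphism $\overline{\mathbb{E}}\times\overline{\mathbb{E}}\to\overline{\mathbb{E}}$ with underlying homomorphism $\overline{\mu}\colon\mathrm{Eq}(\overline{f})\to df$, $$\overline{\mu}\big(\gamma(x,k(a)+x),\gamma(y,k(b)+y)\big)=\gamma\big(x,k(a)+k(b)+x\big)\ \big(=\gamma(y,k(a)+k(b)+y)\big),$$ for all $x,y\in X$ with $f(x)=f(y)$ and all $a,b\in K$.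
   Context: Monoids $K,X,df$ are written additively ($X$ is not assumed commutative) and $M$ multiplicatively with unit $1$. A monoid extension $\mathbb{E}:K\xrightarrow{k}X\xrightarrow{f}M$ consists of a surjective monoid homomorphism $f$ and a kernel $(K,k)$ of $f$. For $m\in M$, the set of representatives of $m$ is $B_m=\{u\in f^{-1}(m): \forall x\in f^{-1}(m)\ \exists!\,a\in K,\ x=k(a)+u\}$, and $B(\mathbb{E})=\bigcup_m B_m$. $\mathbb{E}$ is a Schreier extension if $B_m\neq\emptyset$ for all $m\in M$. $cc\text{-}SExt_M$ is the category of Schreier extensions with fixed codomain $M$ and commutative cancellative kernel; a morphism from $\mathbb{E}$ to $\mathbb{E}': K'\xrightarrow{k'}X'\xrightarrow{f'}M$ is a pair of homomorphisms $(\alpha_1\colon K\to K',\alpha\colon X\to X')$ with $\alpha k=k'\alpha_1$, $f'\alpha=f$ and $\alpha(B(\mathbb{E}))\subseteq B(\mathbb{E}')$; since $\alpha_1$ is determined by $\alpha$, the morphism is also denoted by $\alpha$. The terminal object is $\mathds{1}: 0\to M\xrightarrow{=}M$, and $\mathbb{E}\times\mathbb{E}$ is $K\times K\to\mathrm{Eq}(f)\to M$, where $\mathrm{Eq}(f)=\{(x,y): f(x)=f(y)\}$. Construction of $df$: for $\mathbb{E}$ with commutative cancellative kernel, let $R_{\mathbb{E}}=\{(x,k(a)+x): x\in X,a\in K\}$, a submonoid of $X\times X$ (in each pair the element $a$ is uniquely determined), and let $P_{\mathbb{E}}=\{(x,k(a)+x,k(b)+k(a)+x): x\in X,\ a,b\in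 K\}$, a submonoid of $X^3$. Let $\pi_1,p_2\colon P_{\mathbb{E}}\to R_{\mathbb{E}}$ be the homomorphisms $\pi_1(x,k(a)+x,k(b)+k(a)+x)=(x,k(b)+x)$ and $p_2(x,k(a)+x,k(b)+k(a)+x)=(k(a)+x,k(b)+k(a)+x)$. Let $\gamma\colon R_{\mathbb{E}}\to df$ be a coequaliser of $(\pi_1,p_2)$ in the category of monoids. Define $\overline{f}\colon df\to M$ by $\overline{f}(\gamma(x,k(a)+x))=f(x)$, $\overline{s}\colon M\to df$ by $\overline{s}(m)=\gamma(x,x)$ for any $x$ with $f(x)=m$, and $\overline{\kappa}\colon K\to df$ by $\overline{\kappa}(a)=\gamma(0,k(a))$; these are well-defined homomorphisms. An internal commutative monoid in a category with finite products is meant in the usual sense. *)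

theory Defs
  imports "HOL-Algebra.Divisibility" "HOL-Algebra.Elementary_Groups"
begin

text \<open>
  All monoids are HOL-Algebra structures, hence written multiplicatively: the additive notation of
  the monoids \<open>K\<close>, \<open>X\<close>, \<open>df\<close> becomes \<open>\<otimes>\<close> and \<open>\<one>\<close>. Only commutativity of \<open>K\<close> is ever assumed.
\<close>


section \<open>Monoid homomorphisms and coequalisers\<close>

text \<open>The library's \<open>hom\<close> does not require the unit to be preserved.\<close>

definition mhom :: "('a, 'r) monoid_scheme \<Rightarrow> ('b, 's) monoid_scheme \<Rightarrow> ('a \<Rightarrow> 'b) set" where
  "mhom G H = {h \<in> hom G H. h \<one>\<^bsub>G\<^esub> = \<one>\<^bsub>H\<^esub>}"

definition factors_uniquely ::
    "'b monoid \<Rightarrow> 'c monoid \<Rightarrow> ('b \<Rightarrow> 'c) \<Rightarrow> 'z monoid \<Rightarrow> ('b \<Rightarrow> 'z) \<Rightarrow> bool" where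
  "factors_uniquely B C g Z h \<longleftrightarrow>
     (\<exists>u \<in> mhom C Z. (\<forall>b \<in> carrier B. u (g b) = h b) \<and>
        (\<forall>v \<in> mhom C Z. (\<forall>b \<in> carrier B. v (g b) = h b) \<longrightarrow> (\<forall>c \<in> carrier C. v c = u c)))"

text \<open>
  \<open>g : B \<rightarrow> C\<close> is a coequaliser of the parallel pair \<open>p, q : A \<rightarrow> B\<close> in the category of monoids.
  A definition cannot quantify over the types carrying the test monoids \<open>Z\<close>, so the universal
  property is only demanded for test monoids carried by \<open>'c\<close> and by \<open>'b set\<close>. This is no loss:
  by \<open>is_coequaliser_universal\<close> below it then holds for test monoids carried by any type.
\<close>

definition is_coequaliser ::
    "'a monoid \<Rightarrow> 'b monoid \<Rightarrow> ('a \<Rightarrow> 'b) \<Rightarrow> ('a \<Rightarrow> 'b) \<Rightarrow> ('b \<Rightarrow> 'c) \<Rightarrow> 'c monoid \<Rightarrow> bool" where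
  "is_coequaliser A B p q g C \<longleftrightarrow>
     monoid C \<and> g \<in> mhom B C \<and> (\<forall>a \<in> carrier A. g (p a) = g (q a)) \<and>
     (\<forall>(Z :: 'c monoid) h. monoid Z \<longrightarrow> h \<in> mhom B Z \<longrightarrow>
        (\<forall>a \<in> carrier A. h (p a) = h (q a)) \<longrightarrow> factors_uniquely B C g Z h) \<and>
     (\<forall>(Z :: 'b set monoid) h. monoid Z \<longrightarrow> h \<in> mhom B Z \<longrightarrow>
        (\<forall>a \<in> carrier A. h (p a) = h (q a)) \<longrightarrow> factors_uniquely B C g Z h)"

lemma mhomI:
  assumes "\<And>x. x \<in> carrier G \<Longrightarrow> h x \<in> carrier H"
    and "\<And>x y. x \<in> carrier G \<Longrightarrow> y \<in> carrier G \<Longrightarrow> h (x \<otimes>\<^bsub>G\<^esub> y) = h x \<otimes>\<^bsub>H\<^esub> h y"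
    and "h \<one>\<^bsub>G\<^esub> = \<one>\<^bsub>H\<^esub>"
  shows "h \<in> mhom G H"
  using assms by (auto simp: mhom_def hom_def)

lemma mhom_closed: "h \<in> mhom G H \<Longrightarrow> x \<in> carrier G \<Longrightarrow> h x \<in> carrier H"
  by (auto simp: mhom_def hom_def)

lemma mhom_mult:
  "h \<in> mhom G H \<Longrightarrow> x \<in> carrier G \<Longrightarrow> y \<in> carrier G \<Longrightarrow> h (x \<otimes>\<^bsub>G\<^esub> y) = h x \<otimes>\<^bsub>H\<^esub> h y"
  by (auto simp: mhom_def hom_def)

lemma mhom_one: "h \<in> mhom G H \<Longrightarrow> h \<one>\<^bsub>G\<^esub> = \<one>\<^bsub>H\<^esub>"
  by (auto simp: mhom_def)

lemma mhom_comp: "f \<in> mhom G H \<Longrightarrow> g \<in> mhom H L \<Longrightarrow> g \<circ> f \<in> mhom G L"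
  by (intro mhomI) (auto simp: mhom_closed mhom_mult mhom_one)

text \<open>The image of a homomorphism, carried by its fibres.\<close>

lemma kernel_quotient:
  fixes B :: "'b monoid" and Z :: "'z monoid"
  assumes B: "monoid B" and h: "h \<in> mhom B Z" and Z: "monoid Z"
  obtains Q :: "'b set monoid" and q and j where
    "monoid Q" "q \<in> mhom B Q" "j \<in> mhom Q Z" "\<And>b. b \<in> carrier B \<Longrightarrow> j (q b) = h b"
    "carrier Q = q ` carrier B"
    "\<And>b c. b \<in> carrier B \<Longrightarrow> c \<in> carrier B \<Longrightarrow> q b = q c \<longleftrightarrow> h b = h c"
proof -
  interpret B: monoid B by fact
  interpret Z: monoid Z by fact
  define q where "q b = {c \<in> carrier B. h c = h b}" for b
  define rep where "rep S = (SOME b. b \<in> S)" for S :: "'b set"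
  have rep: "rep (q b) \<in> carrier B" "h (rep (q b)) = h b" if "b \<in> carrier B" for b
  proof -
    have "rep (q b) \<in> q b"
      unfolding rep_def by (rule someI[of _ b]) (use that in \<open>auto simp: q_def\<close>)
    then show "rep (q b) \<in> carrier B" "h (rep (q b)) = h b" by (auto simp: q_def)
  qed
  have q_eq: "q b = q c \<longleftrightarrow> h b = h c" if "b \<in> carrier B" "c \<in> carrier B" for b c
    using that by (auto simp: q_def)
  define Q :: "'b set monoid" where
    "Q = \<lparr>carrier = q ` carrier B, mult = (\<lambda>S T. q (rep S \<otimes>\<^bsub>B\<^esub> rep T)), one = q \<one>\<^bsub>B\<^esub>\<rparr>"
  have qm: "q b \<otimes>\<^bsub>Q\<^esub> q c = q (b \<otimes>\<^bsub>B\<^esub> c)" if "b \<in> carrier B" "c \<in> carrier B" for b c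
    using that by (simp add: Q_def q_eq rep mhom_mult[OF h])
  have Q_simps: "carrier Q = q ` carrier B" "\<one>\<^bsub>Q\<^esub> = q \<one>\<^bsub>B\<^esub>" by (simp_all add: Q_def)
  have "monoid Q"
    by (rule monoidI) (auto simp: Q_simps qm B.m_assoc)
  moreover have "q \<in> mhom B Q"
    by (rule mhomI) (auto simp: Q_simps qm)
  moreover have "h \<circ> rep \<in> mhom Q Z"
    by (rule mhomI) (auto simp: Q_simps qm rep mhom_mult[OF h] mhom_one[OF h] mhom_closed[OF h])
  ultimately show ?thesis
    by (rule that) (auto simp: rep q_eq Q_simps)
qed

lemma is_coequaliser_surj:
  fixes B :: "'b monoid" and C :: "'c monoid"
  assumes B: "monoid B" and p: "p \<in> mhom A B" and q: "q \<in> mhom A B"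
    and C: "is_coequaliser A B p q g C"
  shows "g ` carrier B = carrier C"
proof -
  have monC: "monoid C" and g: "g \<in> mhom B C" and gpq: "\<forall>a \<in> carrier A. g (p a) = g (q a)"
    using C by (auto simp: is_coequaliser_def)
  obtain Q :: "'b set monoid" and r and j where Q: "monoid Q" "r \<in> mhom B Q" "j \<in> mhom Q C"
    and jr: "\<And>b. b \<in> carrier B \<Longrightarrow> j (r b) = g b" and carQ: "carrier Q = r ` carrier B"
    and r: "\<And>b c. b \<in> carrier B \<Longrightarrow> c \<in> carrier B \<Longrightarrow> r b = r c \<longleftrightarrow> g b = g c"
    by (rule kernel_quotient[OF B g monC], rule that, assumption+)
  have "\<forall>a \<in> carrier A. r (p a) = r (q a)"
    using gpq by (simp add: r mhom_closed[OF p] mhom_closed[OF q])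
  then have "factors_uniquely B C g Q r"
    using C Q(1,2) unfolding is_coequaliser_def by blast
  then obtain u where u: "u \<in> mhom C Q" "\<forall>b \<in> carrier B. u (g b) = r b"
    unfolding factors_uniquely_def by blast
  have "factors_uniquely B C g C g"
    using C monC g gpq unfolding is_coequaliser_def by blast
  then obtain w where w:
    "\<And>v. v \<in> mhom C C \<Longrightarrow> \<forall>b \<in> carrier B. v (g b) = g b \<Longrightarrow> \<forall>c \<in> carrier C. v c = w c"
    unfolding factors_uniquely_def by blast
  have "\<forall>c \<in> carrier C. (\<lambda>c. c) c = w c"
    by (rule w) (auto intro: mhomI)
  moreover have "\<forall>c \<in> carrier C. (j \<circ> u) c = w c"
    by (rule w) (use u jr Q(3) in \<open>auto intro: mhom_comp simp del: comp_apply\<close>, simp add: u jr)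
  ultimately have ju: "j (u c) = c" if "c \<in> carrier C" for c using that by simp
  have "c \<in> g ` carrier B" if c: "c \<in> carrier C" for c
  proof -
    obtain b where "b \<in> carrier B" "u c = r b"
      using mhom_closed[OF u(1) c] carQ by auto
    then show ?thesis using ju[OF c] jr by auto
  qed
  then show ?thesis using g by (auto simp: mhom_closed)
qed

theorem is_coequaliser_universal:
  fixes B :: "'b monoid" and C :: "'c monoid" and Z :: "'z monoid"
  assumes B: "monoid B" and p: "p \<in> mhom A B" and q: "q \<in> mhom A B"
    and C: "is_coequaliser A B p q g C"
    and Z: "monoid Z" and h: "h \<in> mhom B Z" and hpq: "\<forall>a \<in> carrier A. h (p a) = h (q a)"
  shows "factors_uniquely B C g Z h"
proof -
  obtain Q :: "'b set monoid" and r and j where Q: "monoid Q" "r \<in> mhom B Q" "j \<in> mhom Q Z"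
    and jr: "\<And>b. b \<in> carrier B \<Longrightarrow> j (r b) = h b" and carQ: "carrier Q = r ` carrier B"
    and r: "\<And>b c. b \<in> carrier B \<Longrightarrow> c \<in> carrier B \<Longrightarrow> r b = r c \<longleftrightarrow> h b = h c"
    by (rule kernel_quotient[OF B h Z], rule that, assumption+)
  have "\<forall>a \<in> carrier A. r (p a) = r (q a)"
    using hpq by (simp add: r mhom_closed[OF p] mhom_closed[OF q])
  then have "factors_uniquely B C g Q r"
    using C Q(1,2) unfolding is_coequaliser_def by blast
  then obtain u where u: "u \<in> mhom C Q" "\<forall>b \<in> carrier B. u (g b) = r b"
    unfolding factors_uniquely_def by blast
  show ?thesis unfolding factors_uniquely_def
  proof (intro bexI[of _ "j \<circ> u"] conjI ballI impI)
    show "j \<circ> u \<in> mhom C Z" using u(1) Q(3) by (rule mhom_comp)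
    show ju: "(j \<circ> u) (g b) = h b" if "b \<in> carrier B" for b using that u jr by simp
    fix v c assume v: "\<forall>b \<in> carrier B. v (g b) = h b" and "c \<in> carrier C"
    then obtain b where "b \<in> carrier B" "c = g b"
      using is_coequaliser_surj[OF B p q C] by blast
    then show "v c = (j \<circ> u) c" using v ju by simp
  qed
qed


section \<open>Schreier extensions\<close>

text \<open>The data of \<open>K \<rightarrow> X \<rightarrow> M\<close>, for a fixed monoid \<open>M\<close> that is not part of the record.\<close>

record ('k, 'x, 'm) mon_ext =
  ext_ker :: "'k monoid"
  ext_inc :: "'k \<Rightarrow> 'x"
  ext_mon :: "'x monoid"
  ext_proj :: "'x \<Rightarrow> 'm"

definition fib :: "('k, 'x, 'm) mon_ext \<Rightarrow> 'm \<Rightarrow> 'x set" where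
  "fib E m = {x \<in> carrier (ext_mon E). ext_proj E x = m}"

text \<open>
  That \<open>(K, k)\<close> is a kernel of \<open>f\<close> means that \<open>k\<close> is, up to an isomorphism, the inclusion of the
  submonoid of elements sent to the unit; see \<open>kernel_universal\<close> below.
\<close>

definition monoid_extension :: "'m monoid \<Rightarrow> ('k, 'x, 'm) mon_ext \<Rightarrow> bool" where
  "monoid_extension M E \<longleftrightarrow>
     monoid M \<and> monoid (ext_ker E) \<and> monoid (ext_mon E) \<and>
     ext_proj E \<in> mhom (ext_mon E) M \<and> ext_proj E ` carrier (ext_mon E) = carrier M \<and>
     ext_inc E \<in> mhom (ext_ker E) (ext_mon E) \<and>
     bij_betw (ext_inc E) (carrier (ext_ker E)) (fib E \<one>\<^bsub>M\<^esub>)"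

definition reps_at :: "('k, 'x, 'm) mon_ext \<Rightarrow> 'm \<Rightarrow> 'x set" where
  "reps_at E m =
     {u \<in> fib E m. \<forall>x \<in> fib E m. \<exists>!a. a \<in> carrier (ext_ker E) \<and> x = ext_inc E a \<otimes>\<^bsub>ext_mon E\<^esub> u}"

definition reps :: "'m monoid \<Rightarrow> ('k, 'x, 'm) mon_ext \<Rightarrow> 'x set" where
  "reps M E = (\<Union>m \<in> carrier M. reps_at E m)"

definition schreier_ext :: "'m monoid \<Rightarrow> ('k, 'x, 'm) mon_ext \<Rightarrow> bool" where
  "schreier_ext M E \<longleftrightarrow> monoid_extension M E \<and> (\<forall>m \<in> carrier M. reps_at E m \<noteq> {})"


section \<open>The category of Schreier extensions with commutative cancellative kernel\<close>

definition cc_schreier_ext :: "'m monoid \<Rightarrow> ('k, 'x, 'm) mon_ext \<Rightarrow> bool" where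
  "cc_schreier_ext M E \<longleftrightarrow> schreier_ext M E \<and> comm_monoid_cancel (ext_ker E)"

text \<open>
  Morphisms \<open>E \<rightarrow> E'\<close>, represented by their component \<open>\<alpha> : X \<rightarrow> X'\<close>, which determines the component
  \<open>\<alpha>1 : K \<rightarrow> K'\<close>. Both extensions are required to be objects of the category. Two functions
  represent the same morphism iff they agree on the carrier of \<open>X\<close>.
\<close>

definition ext_mor ::
    "'m monoid \<Rightarrow> ('k, 'x, 'm) mon_ext \<Rightarrow> ('l, 'y, 'm) mon_ext \<Rightarrow> ('x \<Rightarrow> 'y) \<Rightarrow> bool" where
  "ext_mor M E E' \<alpha> \<longleftrightarrow>
     cc_schreier_ext M E \<and> cc_schreier_ext M E' \<and>
     \<alpha> \<in> mhom (ext_mon E) (ext_mon E') \<and>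
     (\<exists>\<alpha>1 \<in> mhom (ext_ker E) (ext_ker E').
        \<forall>a \<in> carrier (ext_ker E). \<alpha> (ext_inc E a) = ext_inc E' (\<alpha>1 a)) \<and>
     (\<forall>x \<in> carrier (ext_mon E). ext_proj E' (\<alpha> x) = ext_proj E x) \<and>
     \<alpha> ` reps M E \<subseteq> reps M E'"

definition mor_eq :: "('k, 'x, 'm) mon_ext \<Rightarrow> ('x \<Rightarrow> 'y) \<Rightarrow> ('x \<Rightarrow> 'y) \<Rightarrow> bool" where
  "mor_eq E \<alpha> \<beta> \<longleftrightarrow> (\<forall>x \<in> carrier (ext_mon E). \<alpha> x = \<beta> x)"

definition terminal_ext :: "'m monoid \<Rightarrow> (unit, 'm, 'm) mon_ext" where
  "terminal_ext M =
     \<lparr>ext_ker = singleton_group (), ext_inc = (\<lambda>_. \<one>\<^bsub>M\<^esub>), ext_mon = M, ext_proj = (\<lambda>m. m)\<rparr>"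

text \<open>The product \<open>K \<times> K' \<rightarrow> X \<times>\<^sub>M X' \<rightarrow> M\<close>; for \<open>E' = E\<close> the middle monoid is \<open>Eq(f)\<close>.\<close>

definition prod_ext ::
    "('k, 'x, 'm) mon_ext \<Rightarrow> ('l, 'y, 'm) mon_ext \<Rightarrow> ('k \<times> 'l, 'x \<times> 'y, 'm) mon_ext" where
  "prod_ext E E' =
     \<lparr>ext_ker = ext_ker E \<times>\<times> ext_ker E',
      ext_inc = map_prod (ext_inc E) (ext_inc E'),
      ext_mon = (ext_mon E \<times>\<times> ext_mon E')\<lparr>carrier :=
        {(x, y). x \<in> carrier (ext_mon E) \<and> y \<in> carrier (ext_mon E') \<and> ext_proj E x = ext_proj E' y}\<rparr>,
      ext_proj = ext_proj E \<circ> fst\<rparr>"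

text \<open>
  Internal commutative monoids \<open>(E, e : 1 \<rightarrow> E, \<mu> : E \<times> E \<rightarrow> E)\<close>: left and right unit laws,
  associativity and commutativity, as equations between morphisms with domains \<open>1 \<times> E\<close>, \<open>E \<times> 1\<close>,
  \<open>(E \<times> E) \<times> E\<close> and \<open>E \<times> E\<close>.
\<close>

definition internal_comm_monoid ::
    "'m monoid \<Rightarrow> ('k, 'x, 'm) mon_ext \<Rightarrow> ('m \<Rightarrow> 'x) \<Rightarrow> ('x \<times> 'x \<Rightarrow> 'x) \<Rightarrow> bool" where
  "internal_comm_monoid M E e \<mu> \<longleftrightarrow>
     cc_schreier_ext M E \<and>
     ext_mor M (terminal_ext M) E e \<and>
     ext_mor M (prod_ext E E) E \<mu> \<and>
     mor_eq (prod_ext (terminal_ext M) E) (\<mu> \<circ> map_prod e id) snd \<and>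
     mor_eq (prod_ext E (terminal_ext M)) (\<mu> \<circ> map_prod id e) fst \<and>
     mor_eq (prod_ext (prod_ext E E) E)
       (\<mu> \<circ> map_prod \<mu> id) (\<mu> \<circ> map_prod id \<mu> \<circ> (\<lambda>((x, y), z). (x, (y, z)))) \<and>
     mor_eq (prod_ext E E) (\<mu> \<circ> prod.swap) \<mu>"


section \<open>The Schreier point associated with a Schreier extension\<close>

definition R_mon :: "('k, 'x, 'm) mon_ext \<Rightarrow> ('x \<times> 'x) monoid" where
  "R_mon E = (ext_mon E \<times>\<times> ext_mon E)\<lparr>carrier :=
     {(x, ext_inc E a \<otimes>\<^bsub>ext_mon E\<^esub> x) | x a. x \<in> carrier (ext_mon E) \<and> a \<in> carrier (ext_ker E)}\<rparr>"

definition P_mon :: "('k, 'x, 'm) mon_ext \<Rightarrow> ('x \<times> 'x \<times> 'x) monoid" where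
  "P_mon E = (ext_mon E \<times>\<times> ext_mon E \<times>\<times> ext_mon E)\<lparr>carrier :=
     {(x, ext_inc E a \<otimes>\<^bsub>ext_mon E\<^esub> x, ext_inc E b \<otimes>\<^bsub>ext_mon E\<^esub> ext_inc E a \<otimes>\<^bsub>ext_mon E\<^esub> x) | x a b.
       x \<in> carrier (ext_mon E) \<and> a \<in> carrier (ext_ker E) \<and> b \<in> carrier (ext_ker E)}\<rparr>"

text \<open>The element \<open>b\<close> below is unique for triples in \<open>P_mon E\<close>; see \<open>P_pi1_eq\<close>.\<close>

definition P_pi1 :: "('k, 'x, 'm) mon_ext \<Rightarrow> 'x \<times> 'x \<times> 'x \<Rightarrow> 'x \<times> 'x" where
  "P_pi1 E = (\<lambda>(x, y, z).
     (x, ext_inc E (THE b. b \<in> carrier (ext_ker E) \<and> z = ext_inc E b \<otimes>\<^bsub>ext_mon E\<^esub> y) \<otimes>\<^bsub>ext_mon E\<^esub> x))"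

definition P_p2 :: "'x \<times> 'x \<times> 'x \<Rightarrow> 'x \<times> 'x" where
  "P_p2 = (\<lambda>(x, y, z). (y, z))"

text \<open>
  For a coequaliser \<open>\<gamma> : R_mon E \<rightarrow> df\<close> of the two projections, the maps \<open>f\<close>-bar, \<open>s\<close>-bar and
  \<open>\<kappa>\<close>-bar. The descriptions are well-defined by \<open>df_proj_eq\<close> and \<open>df_sect_eq\<close> below.
\<close>

definition df_proj :: "('k, 'x, 'm) mon_ext \<Rightarrow> ('x \<times> 'x \<Rightarrow> 'd) \<Rightarrow> 'd \<Rightarrow> 'm" where
  "df_proj E \<gamma> d = (THE m. \<exists>x \<in> carrier (ext_mon E). \<exists>a \<in> carrier (ext_ker E).
     d = \<gamma> (x, ext_inc E a \<otimes>\<^bsub>ext_mon E\<^esub> x) \<and> m = ext_proj E x)"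

definition df_sect :: "('k, 'x, 'm) mon_ext \<Rightarrow> ('x \<times> 'x \<Rightarrow> 'd) \<Rightarrow> 'm \<Rightarrow> 'd" where
  "df_sect E \<gamma> m = (THE d. \<exists>x \<in> fib E m. d = \<gamma> (x, x))"

definition df_inc :: "('k, 'x, 'm) mon_ext \<Rightarrow> ('x \<times> 'x \<Rightarrow> 'd) \<Rightarrow> 'k \<Rightarrow> 'd" where
  "df_inc E \<gamma> a = \<gamma> (\<one>\<^bsub>ext_mon E\<^esub>, ext_inc E a)"

definition df_ext ::
    "('k, 'x, 'm) mon_ext \<Rightarrow> ('x \<times> 'x \<Rightarrow> 'd) \<Rightarrow> 'd monoid \<Rightarrow> ('k, 'd, 'm) mon_ext" where
  "df_ext E \<gamma> D =
     \<lparr>ext_ker = ext_ker E, ext_inc = df_inc E \<gamma>, ext_mon = D, ext_proj = df_proj E \<gamma>\<rparr>"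

section \<open>Well-definedness of the constructions\<close>

theorem kernel_universal:
  assumes E: "monoid_extension M E" and Z: "monoid Z" and g: "g \<in> mhom Z (ext_mon E)"
    and triv: "\<forall>z \<in> carrier Z. ext_proj E (g z) = \<one>\<^bsub>M\<^esub>"
  shows "\<exists>h \<in> mhom Z (ext_ker E). (\<forall>z \<in> carrier Z. ext_inc E (h z) = g z) \<and>
    (\<forall>h' \<in> mhom Z (ext_ker E). (\<forall>z \<in> carrier Z. ext_inc E (h' z) = g z) \<longrightarrow>
       (\<forall>z \<in> carrier Z. h' z = h z))"
proof -
  interpret Z: monoid Z by fact
  interpret K: monoid "ext_ker E" using E by (simp add: monoid_extension_def)
  have k: "ext_inc E \<in> mhom (ext_ker E) (ext_mon E)"
    and bij: "bij_betw (ext_inc E) (carrier (ext_ker E)) (fib E \<one>\<^bsub>M\<^esub>)"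
    using E by (simp_all add: monoid_extension_def)
  have inj: "inj_on (ext_inc E) (carrier (ext_ker E))" using bij by (rule bij_betw_imp_inj_on)
  define h where "h z = inv_into (carrier (ext_ker E)) (ext_inc E) (g z)" for z
  have gz: "g z \<in> ext_inc E ` carrier (ext_ker E)" if "z \<in> carrier Z" for z
    using that triv mhom_closed[OF g] bij by (auto simp: bij_betw_def fib_def)
  have hz: "h z \<in> carrier (ext_ker E)" "ext_inc E (h z) = g z" if "z \<in> carrier Z" for z
    using gz[OF that] by (auto simp: h_def inv_into_into f_inv_into_f)
  have "h \<in> mhom Z (ext_ker E)"
  proof (rule mhomI)
    show "h x \<in> carrier (ext_ker E)" if "x \<in> carrier Z" for x using that by (rule hz)
    show "h (x \<otimes>\<^bsub>Z\<^esub> y) = h x \<otimes>\<^bsub>ext_ker E\<^esub> h y" if "x \<in> carrier Z" "y \<in> carrier Z" for x y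
      using that by (intro inj_onD[OF inj]) (auto simp: hz mhom_mult[OF k] mhom_mult[OF g])
    show "h \<one>\<^bsub>Z\<^esub> = \<one>\<^bsub>ext_ker E\<^esub>"
      by (intro inj_onD[OF inj]) (auto simp: hz mhom_one[OF k] mhom_one[OF g])
  qed
  moreover have "h' z = h z" if "h' \<in> mhom Z (ext_ker E)" "ext_inc E (h' z) = g z" "z \<in> carrier Z"
    for h' z
    using mhom_closed[OF that(1,3)] that(2,3) by (intro inj_onD[OF inj]) (simp_all add: hz)
  ultimately show ?thesis using hz(2) by (intro bexI[of _ h] conjI ballI impI) blast+
qed

locale cc_ext =
  fixes M :: "'m monoid" and E :: "('k, 'x, 'm) mon_ext"
  assumes cc: "cc_schreier_ext M E"
begin

abbreviation "K \<equiv> ext_ker E"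
abbreviation "X \<equiv> ext_mon E"
abbreviation "k \<equiv> ext_inc E"
abbreviation "f \<equiv> ext_proj E"

sublocale K: comm_monoid_cancel K
  using cc by (simp add: cc_schreier_ext_def)

sublocale X: monoid X
  using cc by (simp add: cc_schreier_ext_def schreier_ext_def monoid_extension_def)

sublocale M: monoid M
  using cc by (simp add: cc_schreier_ext_def schreier_ext_def monoid_extension_def)

lemma mext: "monoid_extension M E"
  using cc by (simp add: cc_schreier_ext_def schreier_ext_def)

lemma f_hom: "f \<in> mhom X M" and k_hom: "k \<in> mhom K X"
  and f_surj: "f ` carrier X = carrier M"
  and k_bij: "bij_betw k (carrier K) (fib E \<one>\<^bsub>M\<^esub>)"
  using mext by (auto simp: monoid_extension_def)

lemma k_closed [simp]: "a \<in> carrier K \<Longrightarrow> k a \<in> carrier X"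
  using k_hom by (rule mhom_closed)

lemma f_closed [simp]: "x \<in> carrier X \<Longrightarrow> f x \<in> carrier M"
  using f_hom by (rule mhom_closed)

lemma f_mult [simp]: "x \<in> carrier X \<Longrightarrow> y \<in> carrier X \<Longrightarrow> f (x \<otimes>\<^bsub>X\<^esub> y) = f x \<otimes>\<^bsub>M\<^esub> f y"
  using f_hom by (rule mhom_mult)

lemma f_one [simp]: "f \<one>\<^bsub>X\<^esub> = \<one>\<^bsub>M\<^esub>"
  using f_hom by (rule mhom_one)

lemma k_mult: "a \<in> carrier K \<Longrightarrow> b \<in> carrier K \<Longrightarrow> k (a \<otimes>\<^bsub>K\<^esub> b) = k a \<otimes>\<^bsub>X\<^esub> k b"
  using k_hom by (rule mhom_mult)

lemma k_one [simp]: "k \<one>\<^bsub>K\<^esub> = \<one>\<^bsub>X\<^esub>"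
  using k_hom by (rule mhom_one)

lemma f_k [simp]: "a \<in> carrier K \<Longrightarrow> f (k a) = \<one>\<^bsub>M\<^esub>"
  using k_bij by (auto simp: bij_betw_def fib_def)

lemma rep_exists:
  assumes "m \<in> carrier M"
  shows "\<exists>u. u \<in> carrier X \<and> f u = m \<and>
    (\<forall>x \<in> carrier X. f x = m \<longrightarrow> (\<exists>!a. a \<in> carrier K \<and> x = k a \<otimes>\<^bsub>X\<^esub> u))"
proof -
  obtain u where "u \<in> reps_at E m"
    using cc assms by (auto simp: cc_schreier_ext_def schreier_ext_def)
  then show ?thesis by (intro exI[of _ u]) (simp add: reps_at_def fib_def)
qed

lemma k_left_cancel:
  assumes x: "x \<in> carrier X" and a: "a \<in> carrier K" and b: "b \<in> carrier K"
    and eq: "k a \<otimes>\<^bsub>X\<^esub> x = k b \<otimes>\<^bsub>X\<^esub> x"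
  shows "a = b"
proof -
  obtain u where u: "u \<in> carrier X" "f u = f x"
    and ex: "\<forall>y \<in> carrier X. f y = f x \<longrightarrow> (\<exists>!a. a \<in> carrier K \<and> y = k a \<otimes>\<^bsub>X\<^esub> u)"
    using rep_exists[OF f_closed[OF x]] by (elim exE conjE)
  obtain c where c: "c \<in> carrier K" "x = k c \<otimes>\<^bsub>X\<^esub> u" using ex x by blast
  have ac: "k a \<otimes>\<^bsub>X\<^esub> x = k (a \<otimes>\<^bsub>K\<^esub> c) \<otimes>\<^bsub>X\<^esub> u"
    using a c u by (simp add: k_mult X.m_assoc)
  have bc: "k a \<otimes>\<^bsub>X\<^esub> x = k (b \<otimes>\<^bsub>K\<^esub> c) \<otimes>\<^bsub>X\<^esub> u"
    unfolding eq using b c u by (simp add: k_mult X.m_assoc)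
  have "\<exists>!d. d \<in> carrier K \<and> k a \<otimes>\<^bsub>X\<^esub> x = k d \<otimes>\<^bsub>X\<^esub> u"
    using a x by (intro ex[rule_format]) simp_all
  then have "a \<otimes>\<^bsub>K\<^esub> c = b \<otimes>\<^bsub>K\<^esub> c"
    by (rule ex1E) (metis K.m_closed a b c(1) ac bc)
  then show ?thesis by (rule K.r_cancel) (fact a b c)+
qed

lemma action_exists:
  assumes y: "y \<in> carrier X" and a: "a \<in> carrier K"
  shows "\<exists>a'. a' \<in> carrier K \<and>
    (\<forall>x \<in> carrier X. f x = f y \<longrightarrow> x \<otimes>\<^bsub>X\<^esub> k a = k a' \<otimes>\<^bsub>X\<^esub> x)"
proof -
  obtain u where u: "u \<in> carrier X" "f u = f y"
    and ex: "\<forall>x \<in> carrier X. f x = f y \<longrightarrow> (\<exists>!a. a \<in> carrier K \<and> x = k a \<otimes>\<^bsub>X\<^esub> u)"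
    using rep_exists[OF f_closed[OF y]] by (elim exE conjE)
  have "\<exists>!d. d \<in> carrier K \<and> u \<otimes>\<^bsub>X\<^esub> k a = k d \<otimes>\<^bsub>X\<^esub> u"
    using u a y by (intro ex[rule_format]) simp_all
  then obtain a' where a': "a' \<in> carrier K" "u \<otimes>\<^bsub>X\<^esub> k a = k a' \<otimes>\<^bsub>X\<^esub> u" by blast
  have "x \<otimes>\<^bsub>X\<^esub> k a = k a' \<otimes>\<^bsub>X\<^esub> x" if x: "x \<in> carrier X" "f x = f y" for x
  proof -
    obtain c where c: "c \<in> carrier K" "x = k c \<otimes>\<^bsub>X\<^esub> u" using ex x by blast
    have "x \<otimes>\<^bsub>X\<^esub> k a = k c \<otimes>\<^bsub>X\<^esub> (u \<otimes>\<^bsub>X\<^esub> k a)" using c u a by (simp add: X.m_assoc)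
    also have "\<dots> = k (c \<otimes>\<^bsub>K\<^esub> a') \<otimes>\<^bsub>X\<^esub> u"
      unfolding a'(2) using c(1) u a'(1) by (simp add: X.m_assoc k_mult)
    also have "\<dots> = k (a' \<otimes>\<^bsub>K\<^esub> c) \<otimes>\<^bsub>X\<^esub> u" using c(1) a'(1) by (simp add: K.m_comm)
    also have "\<dots> = k a' \<otimes>\<^bsub>X\<^esub> x" using c u a'(1) by (simp add: X.m_assoc k_mult)
    finally show ?thesis .
  qed
  then show ?thesis using a'(1) by blast
qed

lemma carrier_R: "carrier (R_mon E) = {(x, k a \<otimes>\<^bsub>X\<^esub> x) | x a. x \<in> carrier X \<and> a \<in> carrier K}"
  and one_R: "\<one>\<^bsub>R_mon E\<^esub> = (\<one>\<^bsub>X\<^esub>, \<one>\<^bsub>X\<^esub>)"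
  and mult_R: "(x, y) \<otimes>\<^bsub>R_mon E\<^esub> (x', y') = (x \<otimes>\<^bsub>X\<^esub> x', y \<otimes>\<^bsub>X\<^esub> y')"
  by (simp_all add: R_mon_def DirProd_def)

lemma carrier_P: "carrier (P_mon E) =
    {(x, k a \<otimes>\<^bsub>X\<^esub> x, k b \<otimes>\<^bsub>X\<^esub> k a \<otimes>\<^bsub>X\<^esub> x) | x a b.
       x \<in> carrier X \<and> a \<in> carrier K \<and> b \<in> carrier K}"
  and one_P: "\<one>\<^bsub>P_mon E\<^esub> = (\<one>\<^bsub>X\<^esub>, \<one>\<^bsub>X\<^esub>, \<one>\<^bsub>X\<^esub>)"
  and mult_P: "(x, y, z) \<otimes>\<^bsub>P_mon E\<^esub> (x', y', z') = (x \<otimes>\<^bsub>X\<^esub> x', y \<otimes>\<^bsub>X\<^esub> y', z \<otimes>\<^bsub>X\<^esub> z')"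
  by (simp_all add: P_mon_def DirProd_def)

lemma P_pi1_eq:
  assumes "x \<in> carrier X" "a \<in> carrier K" "b \<in> carrier K"
  shows "P_pi1 E (x, k a \<otimes>\<^bsub>X\<^esub> x, k b \<otimes>\<^bsub>X\<^esub> k a \<otimes>\<^bsub>X\<^esub> x) = (x, k b \<otimes>\<^bsub>X\<^esub> x)"
proof -
  have "(THE c. c \<in> carrier K \<and> k b \<otimes>\<^bsub>X\<^esub> k a \<otimes>\<^bsub>X\<^esub> x = k c \<otimes>\<^bsub>X\<^esub> (k a \<otimes>\<^bsub>X\<^esub> x)) = b"
  proof (rule the_equality)
    show "b \<in> carrier K \<and> k b \<otimes>\<^bsub>X\<^esub> k a \<otimes>\<^bsub>X\<^esub> x = k b \<otimes>\<^bsub>X\<^esub> (k a \<otimes>\<^bsub>X\<^esub> x)"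
      using assms by (simp add: X.m_assoc)
    show "c = b" if "c \<in> carrier K \<and> k b \<otimes>\<^bsub>X\<^esub> k a \<otimes>\<^bsub>X\<^esub> x = k c \<otimes>\<^bsub>X\<^esub> (k a \<otimes>\<^bsub>X\<^esub> x)" for c
      by (rule k_left_cancel[of "k a \<otimes>\<^bsub>X\<^esub> x"]) (use that assms in \<open>auto simp: X.m_assoc\<close>)
  qed
  then show ?thesis by (simp add: P_pi1_def)
qed

lemma mult_shift:
  assumes "x \<in> carrier X" "y \<in> carrier X" "a \<in> carrier K" "b \<in> carrier K" "b' \<in> carrier K"
    and "x \<otimes>\<^bsub>X\<^esub> k b = k b' \<otimes>\<^bsub>X\<^esub> x"
  shows "(k a \<otimes>\<^bsub>X\<^esub> x) \<otimes>\<^bsub>X\<^esub> (k b \<otimes>\<^bsub>X\<^esub> y) = k (a \<otimes>\<^bsub>K\<^esub> b') \<otimes>\<^bsub>X\<^esub> (x \<otimes>\<^bsub>X\<^esub> y)"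
proof -
  have "(k a \<otimes>\<^bsub>X\<^esub> x) \<otimes>\<^bsub>X\<^esub> (k b \<otimes>\<^bsub>X\<^esub> y) = k a \<otimes>\<^bsub>X\<^esub> ((x \<otimes>\<^bsub>X\<^esub> k b) \<otimes>\<^bsub>X\<^esub> y)"
    using assms(1-5) by (simp add: X.m_assoc)
  also have "\<dots> = k (a \<otimes>\<^bsub>K\<^esub> b') \<otimes>\<^bsub>X\<^esub> (x \<otimes>\<^bsub>X\<^esub> y)"
    using assms by (simp add: X.m_assoc k_mult)
  finally show ?thesis .
qed

lemma R_elem:
  assumes "r \<in> carrier (R_mon E)"
  obtains x a where "r = (x, k a \<otimes>\<^bsub>X\<^esub> x)" "x \<in> carrier X" "a \<in> carrier K"
  using assms unfolding carrier_R by blast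

lemma R_elemI: "x \<in> carrier X \<Longrightarrow> a \<in> carrier K \<Longrightarrow> (x, k a \<otimes>\<^bsub>X\<^esub> x) \<in> carrier (R_mon E)"
  unfolding carrier_R by blast

lemma R_pair:
  assumes "r \<in> carrier (R_mon E)"
  shows "\<exists>x y. r = (x, y) \<and> x \<in> carrier X \<and> y \<in> carrier X"
  using assms by (rule R_elem) simp

lemma monoid_R: "monoid (R_mon E)"
proof (rule monoidI)
  show "\<one>\<^bsub>R_mon E\<^esub> \<in> carrier (R_mon E)"
    using R_elemI[of "\<one>\<^bsub>X\<^esub>" "\<one>\<^bsub>K\<^esub>"] by (simp add: one_R)
  show "r \<otimes>\<^bsub>R_mon E\<^esub> s \<in> carrier (R_mon E)"
    if r: "r \<in> carrier (R_mon E)" and s: "s \<in> carrier (R_mon E)" for r s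
  proof -
    obtain x a where x: "r = (x, k a \<otimes>\<^bsub>X\<^esub> x)" "x \<in> carrier X" "a \<in> carrier K"
      using r by (rule R_elem)
    obtain y b where y: "s = (y, k b \<otimes>\<^bsub>X\<^esub> y)" "y \<in> carrier X" "b \<in> carrier K"
      using s by (rule R_elem)
    obtain b' where b': "b' \<in> carrier K" "x \<otimes>\<^bsub>X\<^esub> k b = k b' \<otimes>\<^bsub>X\<^esub> x"
      using action_exists[OF x(2) y(3)] x(2) by blast
    have "r \<otimes>\<^bsub>R_mon E\<^esub> s = (x \<otimes>\<^bsub>X\<^esub> y, k (a \<otimes>\<^bsub>K\<^esub> b') \<otimes>\<^bsub>X\<^esub> (x \<otimes>\<^bsub>X\<^esub> y))"
      using mult_shift[OF x(2) y(2) x(3) y(3) b'] x(1) y(1) by (simp add: mult_R)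
    moreover have "a \<otimes>\<^bsub>K\<^esub> b' \<in> carrier K" "x \<otimes>\<^bsub>X\<^esub> y \<in> carrier X" using x y b' by simp_all
    ultimately show ?thesis by (simp add: R_elemI)
  qed
  show "(r \<otimes>\<^bsub>R_mon E\<^esub> s) \<otimes>\<^bsub>R_mon E\<^esub> t = r \<otimes>\<^bsub>R_mon E\<^esub> (s \<otimes>\<^bsub>R_mon E\<^esub> t)"
    if "r \<in> carrier (R_mon E)" "s \<in> carrier (R_mon E)" "t \<in> carrier (R_mon E)" for r s t
    using R_pair[OF that(1)] R_pair[OF that(2)] R_pair[OF that(3)]
    by (elim exE conjE) (simp add: mult_R X.m_assoc)
  show "\<one>\<^bsub>R_mon E\<^esub> \<otimes>\<^bsub>R_mon E\<^esub> r = r" "r \<otimes>\<^bsub>R_mon E\<^esub> \<one>\<^bsub>R_mon E\<^esub> = r"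
    if "r \<in> carrier (R_mon E)" for r
    using R_pair[OF that] by (elim exE conjE, simp add: mult_R one_R)+
qed

lemma P_mult_eq:
  assumes x: "x \<in> carrier X" "a \<in> carrier K" "c \<in> carrier K"
    and y: "y \<in> carrier X" "b \<in> carrier K" "d \<in> carrier K"
  obtains b' d' where "b' \<in> carrier K" "d' \<in> carrier K"
    "(x, k a \<otimes>\<^bsub>X\<^esub> x, k c \<otimes>\<^bsub>X\<^esub> k a \<otimes>\<^bsub>X\<^esub> x) \<otimes>\<^bsub>P_mon E\<^esub> (y, k b \<otimes>\<^bsub>X\<^esub> y, k d \<otimes>\<^bsub>X\<^esub> k b \<otimes>\<^bsub>X\<^esub> y)
      = (x \<otimes>\<^bsub>X\<^esub> y, k (a \<otimes>\<^bsub>K\<^esub> b') \<otimes>\<^bsub>X\<^esub> (x \<otimes>\<^bsub>X\<^esub> y),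
          k (c \<otimes>\<^bsub>K\<^esub> d') \<otimes>\<^bsub>X\<^esub> k (a \<otimes>\<^bsub>K\<^esub> b') \<otimes>\<^bsub>X\<^esub> (x \<otimes>\<^bsub>X\<^esub> y))"
    "(k c \<otimes>\<^bsub>X\<^esub> x) \<otimes>\<^bsub>X\<^esub> (k d \<otimes>\<^bsub>X\<^esub> y) = k (c \<otimes>\<^bsub>K\<^esub> d') \<otimes>\<^bsub>X\<^esub> (x \<otimes>\<^bsub>X\<^esub> y)"
proof -
  obtain b' where b': "b' \<in> carrier K" "x \<otimes>\<^bsub>X\<^esub> k b = k b' \<otimes>\<^bsub>X\<^esub> x"
    using action_exists[OF x(1) y(2)] x(1) by blast
  obtain d' where d': "d' \<in> carrier K"
    and d'': "\<forall>z \<in> carrier X. f z = f x \<longrightarrow> z \<otimes>\<^bsub>X\<^esub> k d = k d' \<otimes>\<^bsub>X\<^esub> z"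
    using action_exists[OF x(1) y(3)] by blast
  have 1: "(k a \<otimes>\<^bsub>X\<^esub> x) \<otimes>\<^bsub>X\<^esub> (k b \<otimes>\<^bsub>X\<^esub> y) = k (a \<otimes>\<^bsub>K\<^esub> b') \<otimes>\<^bsub>X\<^esub> (x \<otimes>\<^bsub>X\<^esub> y)"
    using x y b' by (intro mult_shift)
  have "(k c \<otimes>\<^bsub>X\<^esub> (k a \<otimes>\<^bsub>X\<^esub> x)) \<otimes>\<^bsub>X\<^esub> (k d \<otimes>\<^bsub>X\<^esub> (k b \<otimes>\<^bsub>X\<^esub> y))
      = k (c \<otimes>\<^bsub>K\<^esub> d') \<otimes>\<^bsub>X\<^esub> ((k a \<otimes>\<^bsub>X\<^esub> x) \<otimes>\<^bsub>X\<^esub> (k b \<otimes>\<^bsub>X\<^esub> y))"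
    using x y d' by (intro mult_shift d''[rule_format]) simp_all
  then have 2: "(k c \<otimes>\<^bsub>X\<^esub> k a \<otimes>\<^bsub>X\<^esub> x) \<otimes>\<^bsub>X\<^esub> (k d \<otimes>\<^bsub>X\<^esub> k b \<otimes>\<^bsub>X\<^esub> y)
      = k (c \<otimes>\<^bsub>K\<^esub> d') \<otimes>\<^bsub>X\<^esub> k (a \<otimes>\<^bsub>K\<^esub> b') \<otimes>\<^bsub>X\<^esub> (x \<otimes>\<^bsub>X\<^esub> y)"
    using x y b' d' 1 by (simp add: X.m_assoc)
  have 3: "(k c \<otimes>\<^bsub>X\<^esub> x) \<otimes>\<^bsub>X\<^esub> (k d \<otimes>\<^bsub>X\<^esub> y) = k (c \<otimes>\<^bsub>K\<^esub> d') \<otimes>\<^bsub>X\<^esub> (x \<otimes>\<^bsub>X\<^esub> y)"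
    using x y d' by (intro mult_shift d''[rule_format]) simp_all
  show ?thesis by (rule that[OF b'(1) d' _ 3]) (simp only: mult_P 1 2)
qed

lemma P_elem:
  assumes "t \<in> carrier (P_mon E)"
  obtains x a b where "t = (x, k a \<otimes>\<^bsub>X\<^esub> x, k b \<otimes>\<^bsub>X\<^esub> k a \<otimes>\<^bsub>X\<^esub> x)"
    "x \<in> carrier X" "a \<in> carrier K" "b \<in> carrier K"
  using assms unfolding carrier_P by blast

lemma P_elemI:
  "x \<in> carrier X \<Longrightarrow> a \<in> carrier K \<Longrightarrow> b \<in> carrier K \<Longrightarrow>
    (x, k a \<otimes>\<^bsub>X\<^esub> x, k b \<otimes>\<^bsub>X\<^esub> k a \<otimes>\<^bsub>X\<^esub> x) \<in> carrier (P_mon E)"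
  unfolding carrier_P by blast

lemma P_tuple:
  assumes "t \<in> carrier (P_mon E)"
  shows "\<exists>x y z. t = (x, y, z) \<and> x \<in> carrier X \<and> y \<in> carrier X \<and> z \<in> carrier X"
  using assms by (rule P_elem) simp

lemma monoid_P: "monoid (P_mon E)"
proof (rule monoidI)
  show "\<one>\<^bsub>P_mon E\<^esub> \<in> carrier (P_mon E)"
    using P_elemI[of "\<one>\<^bsub>X\<^esub>" "\<one>\<^bsub>K\<^esub>" "\<one>\<^bsub>K\<^esub>"] by (simp add: one_P)
  show "s \<otimes>\<^bsub>P_mon E\<^esub> t \<in> carrier (P_mon E)"
    if s: "s \<in> carrier (P_mon E)" and t: "t \<in> carrier (P_mon E)" for s t
  proof -
    obtain x a c where x: "s = (x, k a \<otimes>\<^bsub>X\<^esub> x, k c \<otimes>\<^bsub>X\<^esub> k a \<otimes>\<^bsub>X\<^esub> x)"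
      "x \<in> carrier X" "a \<in> carrier K" "c \<in> carrier K" using s by (rule P_elem)
    obtain y b d where y: "t = (y, k b \<otimes>\<^bsub>X\<^esub> y, k d \<otimes>\<^bsub>X\<^esub> k b \<otimes>\<^bsub>X\<^esub> y)"
      "y \<in> carrier X" "b \<in> carrier K" "d \<in> carrier K" using t by (rule P_elem)
    show ?thesis unfolding x(1) y(1)
      by (rule P_mult_eq[OF x(2-4) y(2-4)]) (use x y in \<open>simp add: P_elemI\<close>)
  qed
  show "(s \<otimes>\<^bsub>P_mon E\<^esub> t) \<otimes>\<^bsub>P_mon E\<^esub> w = s \<otimes>\<^bsub>P_mon E\<^esub> (t \<otimes>\<^bsub>P_mon E\<^esub> w)"
    if "s \<in> carrier (P_mon E)" "t \<in> carrier (P_mon E)" "w \<in> carrier (P_mon E)" for s t w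
    using P_tuple[OF that(1)] P_tuple[OF that(2)] P_tuple[OF that(3)]
    by (elim exE conjE) (simp add: mult_P X.m_assoc)
  show "\<one>\<^bsub>P_mon E\<^esub> \<otimes>\<^bsub>P_mon E\<^esub> t = t" "t \<otimes>\<^bsub>P_mon E\<^esub> \<one>\<^bsub>P_mon E\<^esub> = t"
    if "t \<in> carrier (P_mon E)" for t
    using P_tuple[OF that] by (elim exE conjE, simp add: mult_P one_P)+
qed

lemma P_pi1_hom: "P_pi1 E \<in> mhom (P_mon E) (R_mon E)"
proof (rule mhomI)
  show "P_pi1 E t \<in> carrier (R_mon E)" if "t \<in> carrier (P_mon E)" for t
    using that by (rule P_elem) (simp add: P_pi1_eq R_elemI)
  show "P_pi1 E (s \<otimes>\<^bsub>P_mon E\<^esub> t) = P_pi1 E s \<otimes>\<^bsub>R_mon E\<^esub> P_pi1 E t"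
    if s: "s \<in> carrier (P_mon E)" and t: "t \<in> carrier (P_mon E)" for s t
  proof -
    obtain x a c where x: "s = (x, k a \<otimes>\<^bsub>X\<^esub> x, k c \<otimes>\<^bsub>X\<^esub> k a \<otimes>\<^bsub>X\<^esub> x)"
      "x \<in> carrier X" "a \<in> carrier K" "c \<in> carrier K" using s by (rule P_elem)
    obtain y b d where y: "t = (y, k b \<otimes>\<^bsub>X\<^esub> y, k d \<otimes>\<^bsub>X\<^esub> k b \<otimes>\<^bsub>X\<^esub> y)"
      "y \<in> carrier X" "b \<in> carrier K" "d \<in> carrier K" using t by (rule P_elem)
    show ?thesis unfolding x(1) y(1)
      by (rule P_mult_eq[OF x(2-4) y(2-4)]) (use x y in \<open>simp add: P_pi1_eq mult_R\<close>)
  qed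
  show "P_pi1 E \<one>\<^bsub>P_mon E\<^esub> = \<one>\<^bsub>R_mon E\<^esub>"
    using P_pi1_eq[of "\<one>\<^bsub>X\<^esub>" "\<one>\<^bsub>K\<^esub>" "\<one>\<^bsub>K\<^esub>"] by (simp add: one_P one_R)
qed

lemma P_p2_hom: "P_p2 \<in> mhom (P_mon E) (R_mon E)"
proof (rule mhomI)
  show "P_p2 t \<in> carrier (R_mon E)" if t: "t \<in> carrier (P_mon E)" for t
  proof -
    obtain x a b where "t = (x, k a \<otimes>\<^bsub>X\<^esub> x, k b \<otimes>\<^bsub>X\<^esub> k a \<otimes>\<^bsub>X\<^esub> x)"
      "x \<in> carrier X" "a \<in> carrier K" "b \<in> carrier K" using t by (rule P_elem)
    then have "P_p2 t = (k a \<otimes>\<^bsub>X\<^esub> x, k b \<otimes>\<^bsub>X\<^esub> (k a \<otimes>\<^bsub>X\<^esub> x))" "k a \<otimes>\<^bsub>X\<^esub> x \<in> carrier X" "b \<in> carrier K"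
      by (simp_all add: P_p2_def X.m_assoc)
    then show ?thesis by (simp add: R_elemI)
  qed
  show "P_p2 (s \<otimes>\<^bsub>P_mon E\<^esub> t) = P_p2 s \<otimes>\<^bsub>R_mon E\<^esub> P_p2 t"
    if "s \<in> carrier (P_mon E)" "t \<in> carrier (P_mon E)" for s t
    using P_tuple[OF that(1)] P_tuple[OF that(2)]
    by (elim exE conjE) (simp add: P_p2_def mult_P mult_R)
  show "P_p2 \<one>\<^bsub>P_mon E\<^esub> = \<one>\<^bsub>R_mon E\<^esub>" by (simp add: P_p2_def one_P one_R)
qed

end

locale cc_ext_df = cc_ext M E
  for M :: "'m monoid" and E :: "('k, 'x, 'm) mon_ext" +
  fixes \<gamma> :: "'x \<times> 'x \<Rightarrow> 'd" and D :: "'d monoid"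
  assumes coeq: "is_coequaliser (P_mon E) (R_mon E) (P_pi1 E) P_p2 \<gamma> D"
begin

lemma \<gamma>_coeq:
  assumes "x \<in> carrier X" "a \<in> carrier K" "b \<in> carrier K"
  shows "\<gamma> (k a \<otimes>\<^bsub>X\<^esub> x, k b \<otimes>\<^bsub>X\<^esub> (k a \<otimes>\<^bsub>X\<^esub> x)) = \<gamma> (x, k b \<otimes>\<^bsub>X\<^esub> x)"
proof -
  have "\<gamma> (P_pi1 E (x, k a \<otimes>\<^bsub>X\<^esub> x, k b \<otimes>\<^bsub>X\<^esub> k a \<otimes>\<^bsub>X\<^esub> x))
      = \<gamma> (P_p2 (x, k a \<otimes>\<^bsub>X\<^esub> x, k b \<otimes>\<^bsub>X\<^esub> k a \<otimes>\<^bsub>X\<^esub> x))"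
    using coeq P_elemI[OF assms] unfolding is_coequaliser_def by blast
  then show ?thesis unfolding P_pi1_eq[OF assms] using assms by (simp add: P_p2_def X.m_assoc)
qed

lemma \<gamma>_fibre:
  assumes x: "x \<in> carrier X" and y: "y \<in> carrier X" and b: "b \<in> carrier K" and eq: "f x = f y"
  shows "\<gamma> (x, k b \<otimes>\<^bsub>X\<^esub> x) = \<gamma> (y, k b \<otimes>\<^bsub>X\<^esub> y)"
proof -
  obtain u where u: "u \<in> carrier X" "f u = f x"
    and ex: "\<forall>z \<in> carrier X. f z = f x \<longrightarrow> (\<exists>!a. a \<in> carrier K \<and> z = k a \<otimes>\<^bsub>X\<^esub> u)"
    using rep_exists[OF f_closed[OF x]] by (elim exE conjE)
  have *: "\<gamma> (z, k b \<otimes>\<^bsub>X\<^esub> z) = \<gamma> (u, k b \<otimes>\<^bsub>X\<^esub> u)" if z: "z \<in> carrier X" "f z = f x" for z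
  proof -
    obtain a where "a \<in> carrier K" "z = k a \<otimes>\<^bsub>X\<^esub> u" using ex z by blast
    then show ?thesis using \<gamma>_coeq[OF u(1)] b by simp
  qed
  show ?thesis using *[OF x refl] *[OF y eq[symmetric]] by simp
qed

lemma df_carrier: "\<gamma> ` carrier (R_mon E) = carrier D"
  by (rule is_coequaliser_surj[OF monoid_R P_pi1_hom P_p2_hom coeq])

theorem df_proj_hom: "df_proj E \<gamma> \<in> mhom D M"
  and df_proj_eq: "x \<in> carrier X \<Longrightarrow> a \<in> carrier K \<Longrightarrow> df_proj E \<gamma> (\<gamma> (x, k a \<otimes>\<^bsub>X\<^esub> x)) = f x"
proof -
  have h: "f \<circ> fst \<in> mhom (R_mon E) M"
  proof (rule mhomI)
    show "(f \<circ> fst) r \<in> carrier M" if "r \<in> carrier (R_mon E)" for r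
      using R_pair[OF that] by auto
    show "(f \<circ> fst) (r \<otimes>\<^bsub>R_mon E\<^esub> s) = (f \<circ> fst) r \<otimes>\<^bsub>M\<^esub> (f \<circ> fst) s"
      if "r \<in> carrier (R_mon E)" "s \<in> carrier (R_mon E)" for r s
      using R_pair[OF that(1)] R_pair[OF that(2)] by (auto simp: mult_R)
  qed (simp add: one_R)
  have "(f \<circ> fst) (P_pi1 E t) = (f \<circ> fst) (P_p2 t)" if t: "t \<in> carrier (P_mon E)" for t
  proof -
    obtain x a b where "t = (x, k a \<otimes>\<^bsub>X\<^esub> x, k b \<otimes>\<^bsub>X\<^esub> k a \<otimes>\<^bsub>X\<^esub> x)"
      "x \<in> carrier X" "a \<in> carrier K" "b \<in> carrier K" using t by (rule P_elem)
    then show ?thesis by (simp add: P_pi1_eq P_p2_def)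
  qed
  then have "factors_uniquely (R_mon E) D \<gamma> M (f \<circ> fst)"
    by (intro is_coequaliser_universal[OF monoid_R P_pi1_hom P_p2_hom coeq M.monoid_axioms h] ballI)
  then obtain u where u: "u \<in> mhom D M" "\<forall>r \<in> carrier (R_mon E). u (\<gamma> r) = (f \<circ> fst) r"
    unfolding factors_uniquely_def by blast
  then have u': "u (\<gamma> (x, k a \<otimes>\<^bsub>X\<^esub> x)) = f x" if "x \<in> carrier X" "a \<in> carrier K" for x a
    using that by (simp add: R_elemI)
  show eq: "df_proj E \<gamma> (\<gamma> (x, k a \<otimes>\<^bsub>X\<^esub> x)) = f x" if "x \<in> carrier X" "a \<in> carrier K" for x a
    unfolding df_proj_def
  proof (rule the_equality)
    fix m assume "\<exists>y \<in> carrier X. \<exists>b \<in> carrier K. \<gamma> (x, k a \<otimes>\<^bsub>X\<^esub> x) = \<gamma> (y, k b \<otimes>\<^bsub>X\<^esub> y) \<and> m = f y"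
    then obtain y b where y: "y \<in> carrier X" "b \<in> carrier K" "m = f y"
      and eq: "\<gamma> (x, k a \<otimes>\<^bsub>X\<^esub> x) = \<gamma> (y, k b \<otimes>\<^bsub>X\<^esub> y)" by blast
    show "m = f x" using u'[OF y(1,2)] u'[OF that] eq y(3) by simp
  next
    show "\<exists>y \<in> carrier X. \<exists>b \<in> carrier K. \<gamma> (x, k a \<otimes>\<^bsub>X\<^esub> x) = \<gamma> (y, k b \<otimes>\<^bsub>X\<^esub> y) \<and> f x = f y"
      by (rule bexI[of _ x], rule bexI[of _ a]) (simp_all add: that)
  qed
  have "df_proj E \<gamma> d = u d" if "d \<in> carrier D" for d
  proof -
    have "d \<in> \<gamma> ` carrier (R_mon E)" using that by (simp only: df_carrier)
    then obtain r where r: "d = \<gamma> r" "r \<in> carrier (R_mon E)" by (rule imageE)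
    obtain x a where x: "r = (x, k a \<otimes>\<^bsub>X\<^esub> x)" "x \<in> carrier X" "a \<in> carrier K"
      using r(2) by (rule R_elem)
    show ?thesis unfolding r(1) x(1) using eq[OF x(2,3)] u'[OF x(2,3)] by simp
  qed
  note * = this
  interpret D: monoid D using coeq by (simp add: is_coequaliser_def)
  show "df_proj E \<gamma> \<in> mhom D M"
  proof (rule mhomI)
    show "df_proj E \<gamma> d \<in> carrier M" if "d \<in> carrier D" for d
      using mhom_closed[OF u(1) that] *[OF that] by simp
    show "df_proj E \<gamma> (d \<otimes>\<^bsub>D\<^esub> d') = df_proj E \<gamma> d \<otimes>\<^bsub>M\<^esub> df_proj E \<gamma> d'"
      if "d \<in> carrier D" "d' \<in> carrier D" for d d'
      using mhom_mult[OF u(1) that] that by (simp add: *)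
    show "df_proj E \<gamma> \<one>\<^bsub>D\<^esub> = \<one>\<^bsub>M\<^esub>"
      using mhom_one[OF u(1)] by (simp add: *)
  qed
qed

theorem df_sect_eq: "x \<in> carrier X \<Longrightarrow> df_sect E \<gamma> (f x) = \<gamma> (x, x)"
  unfolding df_sect_def
proof (rule the_equality)
  assume x: "x \<in> carrier X"
  then show "\<exists>y \<in> fib E (f x). \<gamma> (x, x) = \<gamma> (y, y)" by (auto simp: fib_def)
  fix d assume "\<exists>y \<in> fib E (f x). d = \<gamma> (y, y)"
  then obtain y where "y \<in> carrier X" "f y = f x" "d = \<gamma> (y, y)" by (auto simp: fib_def)
  then show "d = \<gamma> (x, x)" using \<gamma>_fibre[of x y "\<one>\<^bsub>K\<^esub>"] x by simp
qed

end

text \<open>\<open>terminal_ext\<close> and \<open>prod_ext\<close> are the terminal object and the binary product.\<close>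

lemma terminal_ext_obj:
  assumes "monoid M"
  shows "cc_schreier_ext M (terminal_ext M)"
proof -
  interpret M: monoid M by fact
  interpret S: comm_group "singleton_group ()" by simp
  have "comm_monoid_cancel (singleton_group ())" "monoid (singleton_group ())" by unfold_locales
  then show ?thesis
    unfolding cc_schreier_ext_def schreier_ext_def monoid_extension_def reps_at_def fib_def
      terminal_ext_def
    by (auto simp: mhom_def hom_def bij_betw_def M.monoid_axioms singleton_group_def)
qed

theorem terminal_ext_terminal:
  assumes "cc_schreier_ext M E"
  shows "ext_mor M E (terminal_ext M) (ext_proj E)"
    and "ext_mor M E (terminal_ext M) \<beta> \<Longrightarrow> mor_eq E \<beta> (ext_proj E)"
proof -
  interpret cc_ext M E using assms by unfold_locales
  note T = terminal_ext_obj[OF M.monoid_axioms]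
  have all: "reps_at (terminal_ext M) m = {m}" if "m \<in> carrier M" for m
    using that by (auto simp: reps_at_def fib_def terminal_ext_def)
  have "(\<lambda>_. ()) \<in> mhom K (singleton_group ())"
    by (simp add: mhom_def hom_def singleton_group_def)
  then show "ext_mor M E (terminal_ext M) f"
    using assms T f_hom unfolding ext_mor_def reps_def
    by (auto simp: all reps_at_def fib_def) (auto simp: terminal_ext_def)
  show "mor_eq E \<beta> f" if "ext_mor M E (terminal_ext M) \<beta>"
    using that by (auto simp: ext_mor_def mor_eq_def terminal_ext_def)
qed

lemma prod_ext_sel [simp]:
  "ext_ker (prod_ext E E') = ext_ker E \<times>\<times> ext_ker E'"
  "ext_inc (prod_ext E E') = map_prod (ext_inc E) (ext_inc E')"
  "carrier (ext_mon (prod_ext E E')) =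
     {(x, y). x \<in> carrier (ext_mon E) \<and> y \<in> carrier (ext_mon E') \<and> ext_proj E x = ext_proj E' y}"
  "\<one>\<^bsub>ext_mon (prod_ext E E')\<^esub> = (\<one>\<^bsub>ext_mon E\<^esub>, \<one>\<^bsub>ext_mon E'\<^esub>)"
  "(x, y) \<otimes>\<^bsub>ext_mon (prod_ext E E')\<^esub> (x', y') = (x \<otimes>\<^bsub>ext_mon E\<^esub> x', y \<otimes>\<^bsub>ext_mon E'\<^esub> y')"
  "ext_proj (prod_ext E E') = ext_proj E \<circ> fst"
  by (simp_all add: prod_ext_def DirProd_def)

lemma Ex1_prod: "(\<exists>!c. P (fst c) \<and> Q (snd c)) \<longleftrightarrow> (\<exists>!a. P a) \<and> (\<exists>!b. Q b)"
proof (intro iffI conjI)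
  assume "\<exists>!c. P (fst c) \<and> Q (snd c)"
  then obtain c where c: "P (fst c)" "Q (snd c)" and un: "\<forall>d. P (fst d) \<and> Q (snd d) \<longrightarrow> d = c"
    by (elim ex1E conjE)
  have "a = fst c" if "P a" for a using c that un[rule_format, of "(a, snd c)"] by (metis fst_conv snd_conv)
  with c(1) show "\<exists>!a. P a" by (rule ex1I)
  have "b = snd c" if "Q b" for b using c that un[rule_format, of "(fst c, b)"] by (metis fst_conv snd_conv)
  with c(2) show "\<exists>!b. Q b" by (rule ex1I)
next
  assume "(\<exists>!a. P a) \<and> (\<exists>!b. Q b)"
  then obtain a b where ab: "P a" "Q b" and un: "\<forall>a'. P a' \<longrightarrow> a' = a" "\<forall>b'. Q b' \<longrightarrow> b' = b"
    by (elim conjE ex1E)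
  show "\<exists>!c. P (fst c) \<and> Q (snd c)"
  proof (rule ex1I)
    show "P (fst (a, b)) \<and> Q (snd (a, b))" using ab by simp
    show "c = (a, b)" if "P (fst c) \<and> Q (snd c)" for c
      using that un by (simp add: prod_eq_iff)
  qed
qed

lemma Ball_Times_conj:
  assumes "a \<in> A" "b \<in> B"
  shows "(\<forall>z \<in> A \<times> B. P (fst z) \<and> Q (snd z)) \<longleftrightarrow> (\<forall>x \<in> A. P x) \<and> (\<forall>y \<in> B. Q y)"
  using assms by fastforce

lemma reps_at_prod_ext:
  fixes E :: "('k, 'x, 'm) mon_ext" and E' :: "('l, 'y, 'm) mon_ext"
  shows "reps_at (prod_ext E E') m = reps_at E m \<times> reps_at E' m"
proof (rule Set.set_eqI)
  fix w :: "'x \<times> 'y"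
  obtain u v where w: "w = (u, v)" by (cases w)
  define P where "P x a \<longleftrightarrow> a \<in> carrier (ext_ker E) \<and> x = ext_inc E a \<otimes>\<^bsub>ext_mon E\<^esub> u" for x a
  define Q where "Q y b \<longleftrightarrow> b \<in> carrier (ext_ker E') \<and> y = ext_inc E' b \<otimes>\<^bsub>ext_mon E'\<^esub> v" for y b
  have fib: "fib (prod_ext E E') m = fib E m \<times> fib E' m" by (auto simp: fib_def)
  have "(c \<in> carrier (ext_ker (prod_ext E E')) \<and>
        z = ext_inc (prod_ext E E') c \<otimes>\<^bsub>ext_mon (prod_ext E E')\<^esub> (u, v))
      \<longleftrightarrow> P (fst z) (fst c) \<and> Q (snd z) (snd c)" for z c
    by (cases c; cases z) (auto simp: P_def Q_def)
  then have "w \<in> reps_at (prod_ext E E') m \<longleftrightarrow> (u \<in> fib E m \<and> v \<in> fib E' m) \<and>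
      (\<forall>z \<in> fib E m \<times> fib E' m. (\<exists>!a. P (fst z) a) \<and> (\<exists>!b. Q (snd z) b))"
    unfolding reps_at_def w fib by (simp only: mem_Collect_eq mem_Times_iff Ex1_prod fst_conv snd_conv)
  also have "\<dots> \<longleftrightarrow> (u \<in> fib E m \<and> v \<in> fib E' m) \<and>
      (\<forall>x \<in> fib E m. \<exists>!a. P x a) \<and> (\<forall>y \<in> fib E' m. \<exists>!b. Q y b)"
    by (intro conj_cong refl Ball_Times_conj) (elim conjE, assumption)+
  also have "\<dots> \<longleftrightarrow> w \<in> reps_at E m \<times> reps_at E' m"
    unfolding reps_at_def w P_def Q_def
    by (simp only: mem_Collect_eq mem_Times_iff fst_conv snd_conv conj_ac)
  finally show "w \<in> reps_at (prod_ext E E') m \<longleftrightarrow> w \<in> reps_at E m \<times> reps_at E' m" .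
qed

lemma comm_monoid_cancel_DirProd:
  assumes "comm_monoid_cancel G" "comm_monoid_cancel H"
  shows "comm_monoid_cancel (G \<times>\<times> H)"
proof -
  interpret G: comm_monoid_cancel G by fact
  interpret H: comm_monoid_cancel H by fact
  show ?thesis
  proof (rule comm_monoid_cancelI)
    show "comm_monoid (G \<times>\<times> H)"
      by (rule comm_monoidI) (auto simp: G.m_assoc H.m_assoc intro: G.m_comm H.m_comm)
  qed (auto intro: G.r_cancel H.r_cancel)
qed

lemma prod_ext_obj:
  assumes E: "cc_schreier_ext M E" and E': "cc_schreier_ext M E'"
  shows "cc_schreier_ext M (prod_ext E E')"
proof -
  interpret E: cc_ext M E using E by unfold_locales
  interpret E': cc_ext M E' using E' by unfold_locales
  have "comm_monoid_cancel (E.K \<times>\<times> E'.K)"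
    by (rule comm_monoid_cancel_DirProd) unfold_locales
  moreover have "reps_at (prod_ext E E') m \<noteq> {}" if "m \<in> carrier M" for m
    using that E E' by (auto simp: reps_at_prod_ext cc_schreier_ext_def schreier_ext_def)
  moreover have "monoid_extension M (prod_ext E E')"
    unfolding monoid_extension_def
  proof (intro conjI)
    show "monoid M" by (rule E.M.monoid_axioms)
    show "monoid (ext_ker (prod_ext E E'))"
      by (simp add: DirProd_monoid E.K.monoid_axioms E'.K.monoid_axioms)
    show "monoid (ext_mon (prod_ext E E'))"
      by (rule monoidI) (auto simp: E.X.m_assoc E'.X.m_assoc)
    show "ext_proj (prod_ext E E') \<in> mhom (ext_mon (prod_ext E E')) M"
      by (rule mhomI) auto
    show "ext_proj (prod_ext E E') ` carrier (ext_mon (prod_ext E E')) = carrier M"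
    proof (intro equalityI subsetI)
      fix m assume "m \<in> carrier M"
      then obtain x y where "x \<in> carrier E.X" "y \<in> carrier E'.X" "m = E.f x" "m = E'.f y"
        using E.f_surj E'.f_surj by (metis (no_types, lifting) imageE)
      then show "m \<in> ext_proj (prod_ext E E') ` carrier (ext_mon (prod_ext E E'))"
        by (intro image_eqI[of _ _ "(x, y)"]) auto
    qed auto
    show "ext_inc (prod_ext E E') \<in> mhom (ext_ker (prod_ext E E')) (ext_mon (prod_ext E E'))"
      by (rule mhomI) (auto simp: E.k_mult E'.k_mult)
    have "fib (prod_ext E E') \<one>\<^bsub>M\<^esub> = fib E \<one>\<^bsub>M\<^esub> \<times> fib E' \<one>\<^bsub>M\<^esub>" by (auto simp: fib_def)
    then show "bij_betw (ext_inc (prod_ext E E')) (carrier (ext_ker (prod_ext E E')))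
        (fib (prod_ext E E') \<one>\<^bsub>M\<^esub>)"
      using bij_betw_map_prod[OF E.k_bij E'.k_bij] by simp
  qed
  ultimately show ?thesis by (simp add: cc_schreier_ext_def schreier_ext_def)
qed

theorem prod_ext_product:
  assumes E: "cc_schreier_ext M E" and E': "cc_schreier_ext M E'"
  shows "ext_mor M (prod_ext E E') E fst" and "ext_mor M (prod_ext E E') E' snd"
    and "ext_mor M T E \<alpha> \<Longrightarrow> ext_mor M T E' \<beta> \<Longrightarrow>
      ext_mor M T (prod_ext E E') (\<lambda>t. (\<alpha> t, \<beta> t))"
    and "ext_mor M T (prod_ext E E') \<phi> \<Longrightarrow> mor_eq T (fst \<circ> \<phi>) \<alpha> \<Longrightarrow> mor_eq T (snd \<circ> \<phi>) \<beta> \<Longrightarrow>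
      mor_eq T \<phi> (\<lambda>t. (\<alpha> t, \<beta> t))"
proof -
  note P = prod_ext_obj[OF E E']
  have reps: "reps M (prod_ext E E') = (\<Union>m \<in> carrier M. reps_at E m \<times> reps_at E' m)"
    unfolding reps_def by (intro SUP_cong refl reps_at_prod_ext)
  have "fst \<in> mhom (ext_ker (prod_ext E E')) (ext_ker E)"
    "snd \<in> mhom (ext_ker (prod_ext E E')) (ext_ker E')"
    by (auto intro!: mhomI)
  moreover have "fst \<in> mhom (ext_mon (prod_ext E E')) (ext_mon E)"
    "snd \<in> mhom (ext_mon (prod_ext E E')) (ext_mon E')"
    by (auto intro!: mhomI)
  moreover have "fst ` reps M (prod_ext E E') \<subseteq> reps M E"
    "snd ` reps M (prod_ext E E') \<subseteq> reps M E'"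
    unfolding reps by (auto simp: reps_def)
  ultimately show "ext_mor M (prod_ext E E') E fst" "ext_mor M (prod_ext E E') E' snd"
    unfolding ext_mor_def using E E' P
    by (intro conjI; (assumption | force intro: bexI[of _ fst] bexI[of _ snd]))+
  show "ext_mor M T (prod_ext E E') (\<lambda>t. (\<alpha> t, \<beta> t))"
    if \<alpha>: "ext_mor M T E \<alpha>" and \<beta>: "ext_mor M T E' \<beta>"
    unfolding ext_mor_def
  proof (intro conjI)
    show "cc_schreier_ext M T" using \<alpha> by (simp add: ext_mor_def)
    show "cc_schreier_ext M (prod_ext E E')" by (rule P)
    have hom: "\<alpha> \<in> mhom (ext_mon T) (ext_mon E)" "\<beta> \<in> mhom (ext_mon T) (ext_mon E')"
      and over: "\<forall>x \<in> carrier (ext_mon T). ext_proj E (\<alpha> x) = ext_proj T x"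
        "\<forall>x \<in> carrier (ext_mon T). ext_proj E' (\<beta> x) = ext_proj T x"
      using \<alpha> \<beta> by (simp_all add: ext_mor_def)
    show "(\<lambda>t. (\<alpha> t, \<beta> t)) \<in> mhom (ext_mon T) (ext_mon (prod_ext E E'))"
      using over by (intro mhomI) (auto simp: mhom_closed[OF hom(1)] mhom_closed[OF hom(2)]
        mhom_mult[OF hom(1)] mhom_mult[OF hom(2)] mhom_one[OF hom(1)] mhom_one[OF hom(2)])
    show "\<forall>x \<in> carrier (ext_mon T). ext_proj (prod_ext E E') (\<alpha> x, \<beta> x) = ext_proj T x"
      using over by simp
    obtain \<alpha>1 \<beta>1 where k: "\<alpha>1 \<in> mhom (ext_ker T) (ext_ker E)" "\<beta>1 \<in> mhom (ext_ker T) (ext_ker E')"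
      "\<forall>a \<in> carrier (ext_ker T). \<alpha> (ext_inc T a) = ext_inc E (\<alpha>1 a)"
      "\<forall>a \<in> carrier (ext_ker T). \<beta> (ext_inc T a) = ext_inc E' (\<beta>1 a)"
      using \<alpha> \<beta> by (auto simp: ext_mor_def)
    have "(\<lambda>a. (\<alpha>1 a, \<beta>1 a)) \<in> mhom (ext_ker T) (ext_ker (prod_ext E E'))"
      by (intro mhomI) (auto simp: mhom_closed[OF k(1)] mhom_closed[OF k(2)]
        mhom_mult[OF k(1)] mhom_mult[OF k(2)] mhom_one[OF k(1)] mhom_one[OF k(2)])
    then show "\<exists>\<phi> \<in> mhom (ext_ker T) (ext_ker (prod_ext E E')). \<forall>a \<in> carrier (ext_ker T).
        (\<alpha> (ext_inc T a), \<beta> (ext_inc T a)) = ext_inc (prod_ext E E') (\<phi> a)"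
      using k(3,4) by (intro bexI[of _ "\<lambda>a. (\<alpha>1 a, \<beta>1 a)"]) auto
    show "(\<lambda>t. (\<alpha> t, \<beta> t)) ` reps M T \<subseteq> reps M (prod_ext E E')"
    proof clarify
      fix t assume t: "t \<in> reps M T"
      then have tX: "t \<in> carrier (ext_mon T)" by (auto simp: reps_def reps_at_def fib_def)
      have "\<alpha> t \<in> reps M E" "\<beta> t \<in> reps M E'" using \<alpha> \<beta> t by (auto simp: ext_mor_def)
      moreover have "ext_proj E (\<alpha> t) = ext_proj E' (\<beta> t)" using over tX by simp
      ultimately show "(\<alpha> t, \<beta> t) \<in> reps M (prod_ext E E')"
        unfolding reps by (auto simp: reps_def reps_at_def fib_def)
    qed
  qed
  show "mor_eq T \<phi> (\<lambda>t. (\<alpha> t, \<beta> t))" if "mor_eq T (fst \<circ> \<phi>) \<alpha>" "mor_eq T (snd \<circ> \<phi>) \<beta>"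
    using that by (auto simp: mor_eq_def prod_eq_iff)
qed

end

(*
  A Schreier extension with commutative kernel induces an action of M on K, through
  x + k(a) = k(f(x).a) + x. The pair (x, k(a) + x) depends in df only on a and f(x), so df is a
  quotient of the semidirect product of K and M; and (x, k(a) + x) |-> (a, f(x)) is compatible with
  the coequalised pair, so df is that semidirect product. There the multiplication is
  ((a, m), (b, m)) |-> (a + b, m), a homomorphism because M acts by endomorphisms of the
  commutative monoid K.
*)

theory Submission
  imports Defs
begin

section \<open>The action of \<open>M\<close> on \<open>K\<close> by transport through the
  fibres\<close>

context cc_ext
begin

text \<open>The description ranges over the whole fibre, so no point of it has to be chosen;
  \<open>action_exists\<close> supplies such a \<open>b\<close> and \<open>k_left_cancel\<close>
  makes it unique.\<close>

definition act :: "'m \<Rightarrow> 'k \<Rightarrow> 'k" where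
  "act m a = (THE b. b \<in> carrier K \<and> (\<forall>x \<in> fib E m. x \<otimes>\<^bsub>X\<^esub> k a = k b \<otimes>\<^bsub>X\<^esub> x))"

lemma obtain_fib:
  assumes "m \<in> carrier M"
  obtains x where "x \<in> carrier X" "f x = m"
  using assms f_surj by (metis imageE)

text \<open>A single point of the fibre determines the action: the uniform element from
  \<open>action_exists\<close> and \<open>b\<close> both move past \<open>x\<close>, and
  \<open>k_left_cancel\<close> identifies them. The laws of the action are derived by this
  criterion.\<close>

lemma act_unique:
  assumes x: "x \<in> carrier X" and a: "a \<in> carrier K" and b: "b \<in> carrier K"
    and eq: "x \<otimes>\<^bsub>X\<^esub> k a = k b \<otimes>\<^bsub>X\<^esub> x"
  shows "act (f x) a = b"
  unfolding act_def
proof (rule the_equality)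
  obtain c where c: "c \<in> carrier K" "\<forall>y \<in> carrier X. f y = f x \<longrightarrow> y \<otimes>\<^bsub>X\<^esub> k a = k c \<otimes>\<^bsub>X\<^esub> y"
    using action_exists[OF x a] by blast
  have "c = b"
    using x c eq by (intro k_left_cancel[OF x c(1) b]) simp
  then show "b \<in> carrier K \<and> (\<forall>y \<in> fib E (f x). y \<otimes>\<^bsub>X\<^esub> k a = k b \<otimes>\<^bsub>X\<^esub> y)"
    using c by (auto simp: fib_def)
next
  fix c assume c: "c \<in> carrier K \<and> (\<forall>y \<in> fib E (f x). y \<otimes>\<^bsub>X\<^esub> k a = k c \<otimes>\<^bsub>X\<^esub> y)"
  then have "x \<otimes>\<^bsub>X\<^esub> k a = k c \<otimes>\<^bsub>X\<^esub> x" using x by (auto simp: fib_def)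
  then show "c = b" using c eq by (intro k_left_cancel[OF x _ b]) auto
qed

lemma act_closed [simp]:
  assumes m: "m \<in> carrier M" and a: "a \<in> carrier K"
  shows "act m a \<in> carrier K"
proof -
  obtain x where x: "x \<in> carrier X" "f x = m" using m by (rule obtain_fib)
  obtain b where "b \<in> carrier K" "x \<otimes>\<^bsub>X\<^esub> k a = k b \<otimes>\<^bsub>X\<^esub> x" using action_exists[OF x(1) a] x(1) by blast
  then show ?thesis using act_unique[OF x(1) a] x(2) by simp
qed

lemma act_eq:
  assumes x: "x \<in> carrier X" and a: "a \<in> carrier K"
  shows "x \<otimes>\<^bsub>X\<^esub> k a = k (act (f x) a) \<otimes>\<^bsub>X\<^esub> x"
proof -
  obtain b where "b \<in> carrier K" "x \<otimes>\<^bsub>X\<^esub> k a = k b \<otimes>\<^bsub>X\<^esub> x" using action_exists[OF x a] x by blast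
  then show ?thesis using act_unique[OF x a] by simp
qed

lemma act_one_left [simp]: "a \<in> carrier K \<Longrightarrow> act \<one>\<^bsub>M\<^esub> a = a"
  using act_unique[of "\<one>\<^bsub>X\<^esub>" a a] by simp

lemma act_one_right [simp]:
  assumes "m \<in> carrier M"
  shows "act m \<one>\<^bsub>K\<^esub> = \<one>\<^bsub>K\<^esub>"
proof -
  obtain x where "x \<in> carrier X" "f x = m" using assms by (rule obtain_fib)
  then show ?thesis using act_unique[of x "\<one>\<^bsub>K\<^esub>" "\<one>\<^bsub>K\<^esub>"] by simp
qed

text \<open>Moving \<open>k a\<close> leftwards past \<open>y\<close> and then past \<open>x\<close>
  applies the two actions in turn; \<open>act_unique\<close> at the product
  \<open>x \<otimes> y\<close> reads off the result.\<close>

lemma act_mult_left: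
  assumes "m \<in> carrier M" "n \<in> carrier M" and a: "a \<in> carrier K"
  shows "act (m \<otimes>\<^bsub>M\<^esub> n) a = act m (act n a)"
proof -
  obtain x where x: "x \<in> carrier X" "f x = m" using assms(1) by (rule obtain_fib)
  obtain y where y: "y \<in> carrier X" "f y = n" using assms(2) by (rule obtain_fib)
  have b: "act (f y) a \<in> carrier K" using y assms by simp
  have "(x \<otimes>\<^bsub>X\<^esub> y) \<otimes>\<^bsub>X\<^esub> k a = (x \<otimes>\<^bsub>X\<^esub> k (act (f y) a)) \<otimes>\<^bsub>X\<^esub> y"
    using x y assms by (simp add: X.m_assoc act_eq[OF y(1) a])
  also have "\<dots> = k (act (f x) (act (f y) a)) \<otimes>\<^bsub>X\<^esub> (x \<otimes>\<^bsub>X\<^esub> y)"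
    unfolding act_eq[OF x(1) b] using x y assms by (simp add: X.m_assoc)
  finally show ?thesis
    using act_unique[of "x \<otimes>\<^bsub>X\<^esub> y" a "act (f x) (act (f y) a)"] x y assms by simp
qed

text \<open>The factors \<open>k a\<close> and \<open>k b\<close> are moved past the same
  \<open>x\<close>, one after the other.\<close>

lemma act_mult_right:
  assumes "m \<in> carrier M" and a: "a \<in> carrier K" and b: "b \<in> carrier K"
  shows "act m (a \<otimes>\<^bsub>K\<^esub> b) = act m a \<otimes>\<^bsub>K\<^esub> act m b"
proof -
  obtain x where x: "x \<in> carrier X" "f x = m" using assms(1) by (rule obtain_fib)
  have "x \<otimes>\<^bsub>X\<^esub> k (a \<otimes>\<^bsub>K\<^esub> b) = (x \<otimes>\<^bsub>X\<^esub> k a) \<otimes>\<^bsub>X\<^esub> k b"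
    using x a b by (simp add: k_mult X.m_assoc)
  also have "\<dots> = k (act (f x) a) \<otimes>\<^bsub>X\<^esub> (x \<otimes>\<^bsub>X\<^esub> k b)"
    unfolding act_eq[OF x(1) a] using x assms by (simp add: X.m_assoc)
  also have "\<dots> = k (act (f x) a \<otimes>\<^bsub>K\<^esub> act (f x) b) \<otimes>\<^bsub>X\<^esub> x"
    unfolding act_eq[OF x(1) b] using x assms by (simp add: k_mult X.m_assoc)
  finally show ?thesis
    using act_unique[of x "a \<otimes>\<^bsub>K\<^esub> b" "act (f x) a \<otimes>\<^bsub>K\<^esub> act (f x) b"] x assms by simp
qed

section \<open>The semidirect product of \<open>K\<close> and \<open>M\<close>, and coordinates on
  \<open>R_mon E\<close>\<close>

definition semidirect :: "('k \<times> 'm) monoid" where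
  "semidirect = \<lparr>carrier = carrier K \<times> carrier M,
     mult = (\<lambda>(a, m) (b, n). (a \<otimes>\<^bsub>K\<^esub> act m b, m \<otimes>\<^bsub>M\<^esub> n)), one = (\<one>\<^bsub>K\<^esub>, \<one>\<^bsub>M\<^esub>)\<rparr>"

lemma monoid_semidirect: "monoid semidirect"
  by (rule monoidI)
    (auto simp: semidirect_def act_mult_left act_mult_right K.m_assoc M.m_assoc)

definition R_coord :: "'x \<times> 'x \<Rightarrow> 'k \<times> 'm" where
  "R_coord = (\<lambda>(x, y). (THE a. a \<in> carrier K \<and> y = k a \<otimes>\<^bsub>X\<^esub> x, f x))"

lemma R_coord_eq:
  assumes "x \<in> carrier X" "a \<in> carrier K"
  shows "R_coord (x, k a \<otimes>\<^bsub>X\<^esub> x) = (a, f x)"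
  using assms by (auto simp: R_coord_def intro!: the_equality intro: k_left_cancel[of x])

text \<open>When two pairs are multiplied, the kernel factor of the second has to pass the base
  point \<open>x\<close> of the first. This replaces \<open>b\<close> by \<open>act (f x) b\<close>,
  which is the twist in the semidirect product.\<close>

lemma R_coord_hom: "R_coord \<in> mhom (R_mon E) semidirect"
proof (rule mhomI)
  show "R_coord r \<in> carrier semidirect" if "r \<in> carrier (R_mon E)" for r
    using that by (rule R_elem) (simp add: R_coord_eq semidirect_def)
  show "R_coord (r \<otimes>\<^bsub>R_mon E\<^esub> s) = R_coord r \<otimes>\<^bsub>semidirect\<^esub> R_coord s"
    if r: "r \<in> carrier (R_mon E)" and s: "s \<in> carrier (R_mon E)" for r s
  proof -
    obtain x a where x: "r = (x, k a \<otimes>\<^bsub>X\<^esub> x)" "x \<in> carrier X" "a \<in> carrier K"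
      using r by (rule R_elem)
    obtain y b where y: "s = (y, k b \<otimes>\<^bsub>X\<^esub> y)" "y \<in> carrier X" "b \<in> carrier K"
      using s by (rule R_elem)
    have "r \<otimes>\<^bsub>R_mon E\<^esub> s = (x \<otimes>\<^bsub>X\<^esub> y, k (a \<otimes>\<^bsub>K\<^esub> act (f x) b) \<otimes>\<^bsub>X\<^esub> (x \<otimes>\<^bsub>X\<^esub> y))"
      using mult_shift[OF x(2) y(2) x(3) y(3) _ act_eq[OF x(2) y(3)]] x y by (simp add: mult_R)
    then show ?thesis using x y by (simp add: R_coord_eq semidirect_def)
  qed
  show "R_coord \<one>\<^bsub>R_mon E\<^esub> = \<one>\<^bsub>semidirect\<^esub>"
    using R_coord_eq[of "\<one>\<^bsub>X\<^esub>" "\<one>\<^bsub>K\<^esub>"] by (simp add: one_R semidirect_def)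
qed

end

section \<open>Coordinates on the coequaliser \<open>D\<close>\<close>

context cc_ext_df
begin

sublocale D: monoid D
  using coeq by (simp add: is_coequaliser_def)

lemma \<gamma>_hom: "\<gamma> \<in> mhom (R_mon E) D"
  using coeq by (simp add: is_coequaliser_def)

text \<open>A factorisation of \<open>R_coord\<close> through \<open>\<gamma>\<close>; that one
  exists is shown in the proof of \<open>df_coord_eq\<close>.\<close>

definition df_coord :: "'d \<Rightarrow> 'k \<times> 'm" where
  "df_coord = (SOME u. u \<in> mhom D semidirect \<and> (\<forall>r \<in> carrier (R_mon E). u (\<gamma> r) = R_coord r))"

text \<open>\<open>R_coord\<close> equalises the parallel pair: both images of a triple have the
  same second kernel factor \<open>b\<close>, and their base points differ by some
  \<open>k c\<close>, which \<open>f\<close> sends to the unit. Hence passing to \<open>D\<close>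
  loses neither \<open>a\<close> nor \<open>f x\<close>.\<close>

lemma df_coord_eq:
  assumes x: "x \<in> carrier X" and a: "a \<in> carrier K"
  shows "df_coord (\<gamma> (x, k a \<otimes>\<^bsub>X\<^esub> x)) = (a, f x)"
proof -
  have "R_coord (P_pi1 E t) = R_coord (P_p2 t)" if t: "t \<in> carrier (P_mon E)" for t
  proof -
    obtain y c b where y: "t = (y, k c \<otimes>\<^bsub>X\<^esub> y, k b \<otimes>\<^bsub>X\<^esub> k c \<otimes>\<^bsub>X\<^esub> y)"
      "y \<in> carrier X" "c \<in> carrier K" "b \<in> carrier K" using t by (rule P_elem)
    have "R_coord (P_p2 t) = R_coord (k c \<otimes>\<^bsub>X\<^esub> y, k b \<otimes>\<^bsub>X\<^esub> (k c \<otimes>\<^bsub>X\<^esub> y))"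
      using y by (simp add: P_p2_def X.m_assoc)
    also have "\<dots> = (b, f y)" using y by (subst R_coord_eq) simp_all
    finally show ?thesis using y by (simp add: P_pi1_eq R_coord_eq)
  qed
  \<comment> \<open>The test monoid lives on the type \<open>'k \<times> 'm\<close>, so the
    type-independent form of the universal property is used.\<close>
  then have "factors_uniquely (R_mon E) D \<gamma> semidirect R_coord"
    by (intro is_coequaliser_universal[OF monoid_R P_pi1_hom P_p2_hom coeq monoid_semidirect
      R_coord_hom] ballI)
  then have "\<exists>u. u \<in> mhom D semidirect \<and> (\<forall>r \<in> carrier (R_mon E). u (\<gamma> r) = R_coord r)"
    unfolding factors_uniquely_def by blast
  then have "df_coord \<in> mhom D semidirect \<and> (\<forall>r \<in> carrier (R_mon E). df_coord (\<gamma> r) = R_coord r)"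
    unfolding df_coord_def by (rule someI_ex)
  then show ?thesis using x a by (simp add: R_elemI R_coord_eq)
qed

text \<open>The inverse of \<open>df_coord\<close>. Writing it as a product in \<open>D\<close>
  avoids choosing a point of the fibre over \<open>m\<close>.\<close>

definition df_elem :: "'k \<Rightarrow> 'm \<Rightarrow> 'd" where
  "df_elem a m = df_inc E \<gamma> a \<otimes>\<^bsub>D\<^esub> df_sect E \<gamma> m"

text \<open>In \<open>R_mon E\<close> the pair \<open>(x, k a \<otimes> x)\<close> is the product of
  \<open>(\<one>, k a)\<close> and \<open>(x, x)\<close>, and \<open>\<gamma>\<close> is a
  homomorphism.\<close>

lemma df_elem_eq:
  assumes x: "x \<in> carrier X" and a: "a \<in> carrier K"
  shows "df_elem a (f x) = \<gamma> (x, k a \<otimes>\<^bsub>X\<^esub> x)"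
proof -
  have "(\<one>\<^bsub>X\<^esub>, k a) \<in> carrier (R_mon E)" "(x, x) \<in> carrier (R_mon E)"
    using R_elemI[of "\<one>\<^bsub>X\<^esub>" a] R_elemI[of x "\<one>\<^bsub>K\<^esub>"] x a by simp_all
  then have "\<gamma> (\<one>\<^bsub>X\<^esub>, k a) \<otimes>\<^bsub>D\<^esub> \<gamma> (x, x) = \<gamma> ((\<one>\<^bsub>X\<^esub>, k a) \<otimes>\<^bsub>R_mon E\<^esub> (x, x))"
    by (simp add: mhom_mult[OF \<gamma>_hom])
  then show ?thesis using x by (simp add: df_elem_def df_inc_def df_sect_eq mult_R)
qed

lemma df_elem_closed [simp]:
  assumes "a \<in> carrier K" "m \<in> carrier M"
  shows "df_elem a m \<in> carrier D"
proof -
  obtain x where "x \<in> carrier X" "f x = m" using assms(2) by (rule obtain_fib)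
  then show ?thesis using df_elem_eq[of x a] mhom_closed[OF \<gamma>_hom] assms(1) by (auto simp: R_elemI)
qed

lemma df_coord_elem [simp]:
  assumes "a \<in> carrier K" "m \<in> carrier M"
  shows "df_coord (df_elem a m) = (a, m)"
proof -
  obtain x where "x \<in> carrier X" "f x = m" using assms(2) by (rule obtain_fib)
  then show ?thesis using df_elem_eq[of x a] df_coord_eq[of x a] assms(1) by simp
qed

lemma df_proj_elem [simp]:
  assumes "a \<in> carrier K" "m \<in> carrier M"
  shows "df_proj E \<gamma> (df_elem a m) = m"
proof -
  obtain x where "x \<in> carrier X" "f x = m" using assms(2) by (rule obtain_fib)
  then show ?thesis using df_elem_eq[of x a] df_proj_eq[of x a] assms(1) by simp
qed

lemma df_elem_inject:
  assumes "a \<in> carrier K" "m \<in> carrier M" "b \<in> carrier K" "n \<in> carrier M"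
  shows "df_elem a m = df_elem b n \<longleftrightarrow> a = b \<and> m = n"
  using assms by (metis df_coord_elem prod.inject)

text \<open>Every element of \<open>D\<close> has coordinates because \<open>\<gamma>\<close> is
  surjective; by \<open>df_elem_inject\<close> they are unique. Later arguments about
  \<open>D\<close> are carried out in these coordinates.\<close>

lemma df_cases:
  assumes "d \<in> carrier D"
  obtains a m where "a \<in> carrier K" "m \<in> carrier M" "d = df_elem a m"
proof -
  obtain r where r: "d = \<gamma> r" "r \<in> carrier (R_mon E)" using assms df_carrier by blast
  obtain x a where x: "r = (x, k a \<otimes>\<^bsub>X\<^esub> x)" "x \<in> carrier X" "a \<in> carrier K"
    using r(2) by (rule R_elem)
  show ?thesis by (rule that[of a "f x"]) (use r(1) x in \<open>simp_all add: df_elem_eq\<close>)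
qed

text \<open>The computation behind \<open>R_coord_hom\<close>, pushed forward along
  \<open>\<gamma>\<close>: the bijection with the semidirect product respects
  multiplication.\<close>

lemma df_elem_mult:
  assumes a: "a \<in> carrier K" and m: "m \<in> carrier M" and b: "b \<in> carrier K" and n: "n \<in> carrier M"
  shows "df_elem a m \<otimes>\<^bsub>D\<^esub> df_elem b n = df_elem (a \<otimes>\<^bsub>K\<^esub> act m b) (m \<otimes>\<^bsub>M\<^esub> n)"
proof -
  obtain x where x: "x \<in> carrier X" "f x = m" using m by (rule obtain_fib)
  obtain y where y: "y \<in> carrier X" "f y = n" using n by (rule obtain_fib)
  have "df_elem a m \<otimes>\<^bsub>D\<^esub> df_elem b n = \<gamma> ((x, k a \<otimes>\<^bsub>X\<^esub> x) \<otimes>\<^bsub>R_mon E\<^esub> (y, k b \<otimes>\<^bsub>X\<^esub> y))"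
    using x y a b by (auto simp: df_elem_eq mhom_mult[OF \<gamma>_hom] R_elemI)
  also have "\<dots> = \<gamma> (x \<otimes>\<^bsub>X\<^esub> y, k (a \<otimes>\<^bsub>K\<^esub> act (f x) b) \<otimes>\<^bsub>X\<^esub> (x \<otimes>\<^bsub>X\<^esub> y))"
    using mult_shift[OF x(1) y(1) a b _ act_eq[OF x(1) b]] x y assms by (simp add: mult_R)
  also have "\<dots> = df_elem (a \<otimes>\<^bsub>K\<^esub> act m b) (m \<otimes>\<^bsub>M\<^esub> n)"
    using df_elem_eq[of "x \<otimes>\<^bsub>X\<^esub> y" "a \<otimes>\<^bsub>K\<^esub> act m b"] x y assms by auto
  finally show ?thesis .
qed

lemma df_inc_elem: "a \<in> carrier K \<Longrightarrow> df_inc E \<gamma> a = df_elem a \<one>\<^bsub>M\<^esub>"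
  using df_elem_eq[of "\<one>\<^bsub>X\<^esub>" a] by (simp add: df_inc_def)

lemma df_sect_elem:
  assumes "m \<in> carrier M"
  shows "df_sect E \<gamma> m = df_elem \<one>\<^bsub>K\<^esub> m"
proof -
  obtain x where "x \<in> carrier X" "f x = m" using assms by (rule obtain_fib)
  then show ?thesis using df_elem_eq[of x "\<one>\<^bsub>K\<^esub>"] df_sect_eq[of x] by simp
qed

lemma df_one_elem: "\<one>\<^bsub>D\<^esub> = df_elem \<one>\<^bsub>K\<^esub> \<one>\<^bsub>M\<^esub>"
  using df_elem_eq[of "\<one>\<^bsub>X\<^esub>" "\<one>\<^bsub>K\<^esub>"] mhom_one[OF \<gamma>_hom] by (simp add: one_R)

section \<open>The Schreier extension carried by \<open>D\<close> and its representatives\<close>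

lemma df_ext_sel [simp]:
  "ext_ker (df_ext E \<gamma> D) = K" "ext_inc (df_ext E \<gamma> D) = df_inc E \<gamma>"
  "ext_mon (df_ext E \<gamma> D) = D" "ext_proj (df_ext E \<gamma> D) = df_proj E \<gamma>"
  by (simp_all add: df_ext_def)

lemma fib_df_ext:
  assumes "m \<in> carrier M"
  shows "fib (df_ext E \<gamma> D) m = (\<lambda>a. df_elem a m) ` carrier K"
proof (intro equalityI subsetI)
  fix d assume "d \<in> fib (df_ext E \<gamma> D) m"
  then have d: "d \<in> carrier D" "df_proj E \<gamma> d = m" by (simp_all add: fib_def)
  show "d \<in> (\<lambda>a. df_elem a m) ` carrier K"
    using d(1) by (rule df_cases) (use d(2) in auto)
qed (use assms in \<open>auto simp: fib_def\<close>)

text \<open>The unit of \<open>M\<close> acts trivially, so multiplying by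
  \<open>df_inc E \<gamma> b\<close> on the left only changes the coordinate \<open>a\<close> to
  \<open>b \<otimes> a\<close>. Being a representative thus means that every \<open>c\<close> in
  \<open>K\<close> is uniquely of the form \<open>b \<otimes> a\<close>, that is, \<open>a\<close>
  is invertible.\<close>

lemma reps_at_df_ext:
  assumes m: "m \<in> carrier M"
  shows "reps_at (df_ext E \<gamma> D) m = (\<lambda>a. df_elem a m) ` Units K"
proof -
  have *: "df_inc E \<gamma> b \<otimes>\<^bsub>D\<^esub> df_elem a m = df_elem (b \<otimes>\<^bsub>K\<^esub> a) m"
    if "a \<in> carrier K" "b \<in> carrier K" for a b
    using that m by (simp add: df_inc_elem df_elem_mult)
  have rep: "df_elem a m \<in> reps_at (df_ext E \<gamma> D) m \<longleftrightarrow>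
      (\<forall>c \<in> carrier K. \<exists>!b. b \<in> carrier K \<and> c = b \<otimes>\<^bsub>K\<^esub> a)" if a: "a \<in> carrier K" for a
  proof -
    have "(b \<in> carrier K \<and> df_elem c m = df_inc E \<gamma> b \<otimes>\<^bsub>D\<^esub> df_elem a m) \<longleftrightarrow>
        (b \<in> carrier K \<and> c = b \<otimes>\<^bsub>K\<^esub> a)" if "c \<in> carrier K" for b c
      using a that m by (auto simp: * df_elem_inject)
    then show ?thesis using a by (simp add: reps_at_def fib_df_ext[OF m])
  qed
  have unit: "(\<forall>c \<in> carrier K. \<exists>!b. b \<in> carrier K \<and> c = b \<otimes>\<^bsub>K\<^esub> a) \<longleftrightarrow> a \<in> Units K"
    if a: "a \<in> carrier K" for a
  proof
    assume "\<forall>c \<in> carrier K. \<exists>!b. b \<in> carrier K \<and> c = b \<otimes>\<^bsub>K\<^esub> a"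
    \<comment> \<open>The case \<open>c = \<one>\<close> yields a left inverse, two-sided by
      commutativity.\<close>
    then obtain b where "b \<in> carrier K" "\<one>\<^bsub>K\<^esub> = b \<otimes>\<^bsub>K\<^esub> a" by (metis K.one_closed)
    then show "a \<in> Units K" using a K.m_comm[of a b]
      by (auto simp: Units_def intro!: bexI[of _ b])
  next
    assume "a \<in> Units K"
    then obtain b where b: "b \<in> carrier K" "b \<otimes>\<^bsub>K\<^esub> a = \<one>\<^bsub>K\<^esub>" by (auto simp: Units_def)
    have c: "c = (c \<otimes>\<^bsub>K\<^esub> b) \<otimes>\<^bsub>K\<^esub> a" if "c \<in> carrier K" for c
      using that a b by (simp add: K.m_assoc)
    show "\<forall>c \<in> carrier K. \<exists>!b. b \<in> carrier K \<and> c = b \<otimes>\<^bsub>K\<^esub> a"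
    proof (intro ballI ex1I conjI)
      show "c \<otimes>\<^bsub>K\<^esub> b \<in> carrier K" "c = (c \<otimes>\<^bsub>K\<^esub> b) \<otimes>\<^bsub>K\<^esub> a" if "c \<in> carrier K" for c
        using that b c by simp_all
      show "d = c \<otimes>\<^bsub>K\<^esub> b" if "c \<in> carrier K" "d \<in> carrier K \<and> c = d \<otimes>\<^bsub>K\<^esub> a" for c d
        by (rule K.r_cancel[of _ a]) (use that a b c[OF that(1)] in auto)
    qed
  qed
  have "reps_at (df_ext E \<gamma> D) m \<subseteq> (\<lambda>a. df_elem a m) ` carrier K"
    by (auto simp: reps_at_def fib_df_ext[OF m])
  then show ?thesis using rep unit by (auto simp: K.Units_closed)
qed

lemma df_inc_hom: "df_inc E \<gamma> \<in> mhom K D"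
  by (rule mhomI) (simp_all add: df_inc_elem df_elem_mult df_one_elem)

lemma df_sect_hom: "df_sect E \<gamma> \<in> mhom M D"
  by (rule mhomI) (simp_all add: df_sect_elem df_elem_mult df_one_elem)

text \<open>The elements over the unit of \<open>M\<close> are the \<open>df_elem a \<one>\<close>,
  which are the values of \<open>df_inc E \<gamma>\<close>; each fibre has the representative
  \<open>df_elem \<one> m\<close>, since \<open>\<one>\<close> is invertible.\<close>

lemma df_ext_obj: "cc_schreier_ext M (df_ext E \<gamma> D)"
proof -
  have "df_proj E \<gamma> ` carrier D = carrier M"
  proof (intro equalityI subsetI)
    show "m \<in> df_proj E \<gamma> ` carrier D" if "m \<in> carrier M" for m
      using that by (intro image_eqI[of _ _ "df_elem \<one>\<^bsub>K\<^esub> m"]) simp_all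
  qed (use mhom_closed[OF df_proj_hom] in auto)
  moreover have "bij_betw (df_inc E \<gamma>) (carrier K) (fib (df_ext E \<gamma> D) \<one>\<^bsub>M\<^esub>)"
    by (auto simp: bij_betw_def inj_on_def fib_df_ext df_inc_elem df_elem_inject)
  moreover have "reps_at (df_ext E \<gamma> D) m \<noteq> {}" if "m \<in> carrier M" for m
    using K.Units_one_closed by (auto simp: reps_at_df_ext[OF that])
  ultimately show ?thesis
    by (simp add: cc_schreier_ext_def schreier_ext_def monoid_extension_def M.monoid_axioms
      K.monoid_axioms D.monoid_axioms K.comm_monoid_cancel_axioms df_proj_hom df_inc_hom)
qed

section \<open>The fibrewise multiplication and the internal monoid laws\<close>

definition df_mult :: "'d \<times> 'd \<Rightarrow> 'd" where
  "df_mult = (\<lambda>(d, e). df_elem (fst (df_coord d) \<otimes>\<^bsub>K\<^esub> fst (df_coord e)) (df_proj E \<gamma> d))"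

lemma df_mult_elem [simp]:
  assumes "a \<in> carrier K" "b \<in> carrier K" "m \<in> carrier M"
  shows "df_mult (df_elem a m, df_elem b m) = df_elem (a \<otimes>\<^bsub>K\<^esub> b) m"
  using assms by (simp add: df_mult_def)

lemma df_mult_\<gamma>:
  assumes "x \<in> carrier X" "y \<in> carrier X" "a \<in> carrier K" "b \<in> carrier K" "f x = f y"
  shows "df_mult (\<gamma> (x, k a \<otimes>\<^bsub>X\<^esub> x), \<gamma> (y, k b \<otimes>\<^bsub>X\<^esub> y)) = \<gamma> (x, k a \<otimes>\<^bsub>X\<^esub> k b \<otimes>\<^bsub>X\<^esub> x)"
proof -
  have "\<gamma> (x, k a \<otimes>\<^bsub>X\<^esub> x) = df_elem a (f x)" "\<gamma> (y, k b \<otimes>\<^bsub>X\<^esub> y) = df_elem b (f x)"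
    "\<gamma> (x, k a \<otimes>\<^bsub>X\<^esub> k b \<otimes>\<^bsub>X\<^esub> x) = df_elem (a \<otimes>\<^bsub>K\<^esub> b) (f x)"
    using df_elem_eq[of x a] df_elem_eq[of y b] df_elem_eq[of x "a \<otimes>\<^bsub>K\<^esub> b"] assms(1-4)
    by (simp_all add: assms(5) k_mult)
  then show ?thesis using assms(1,3,4) by simp
qed

text \<open>Equal projections force a common coordinate \<open>m\<close>. On such pairs it does not
  matter that \<open>df_mult\<close> takes the \<open>M\<close>-coordinate from the first
  component.\<close>

lemma df_pair_cases:
  assumes "w \<in> carrier (ext_mon (prod_ext (df_ext E \<gamma> D) (df_ext E \<gamma> D)))"
  obtains a b m where "a \<in> carrier K" "b \<in> carrier K" "m \<in> carrier M"
    "w = (df_elem a m, df_elem b m)"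
proof -
  obtain d e where w: "w = (d, e)" "d \<in> carrier D" "e \<in> carrier D"
    and eq: "df_proj E \<gamma> d = df_proj E \<gamma> e"
    using assms by auto
  obtain a m where d: "a \<in> carrier K" "m \<in> carrier M" "d = df_elem a m" using w(2) by (rule df_cases)
  obtain b n where e: "b \<in> carrier K" "n \<in> carrier M" "e = df_elem b n" using w(3) by (rule df_cases)
  show ?thesis using eq by (intro that[of a b m]) (simp_all add: w d e)
qed

lemma df_mult_hom:
  "df_mult \<in> mhom (ext_mon (prod_ext (df_ext E \<gamma> D) (df_ext E \<gamma> D))) D" (is "_ \<in> mhom ?EE D")
proof (rule mhomI)
  show "df_mult w \<in> carrier D" if "w \<in> carrier ?EE" for w
    using that by (rule df_pair_cases) simp
  show "df_mult (w \<otimes>\<^bsub>?EE\<^esub> z) = df_mult w \<otimes>\<^bsub>D\<^esub> df_mult z"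
    if w: "w \<in> carrier ?EE" and z: "z \<in> carrier ?EE" for w z
  proof -
    obtain a b m where w': "a \<in> carrier K" "b \<in> carrier K" "m \<in> carrier M"
      "w = (df_elem a m, df_elem b m)" using w by (rule df_pair_cases)
    obtain c d n where z': "c \<in> carrier K" "d \<in> carrier K" "n \<in> carrier M"
      "z = (df_elem c n, df_elem d n)" using z by (rule df_pair_cases)
    \<comment> \<open>The interchange law between the product of \<open>D\<close> and the fibrewise
      product, on \<open>K\<close>-coordinates: \<open>b\<close> is commuted past
      \<open>act m c\<close>, and \<open>act m\<close> is multiplicative.\<close>
    have "(a \<otimes>\<^bsub>K\<^esub> act m c) \<otimes>\<^bsub>K\<^esub> (b \<otimes>\<^bsub>K\<^esub> act m d) = (a \<otimes>\<^bsub>K\<^esub> b) \<otimes>\<^bsub>K\<^esub> act m (c \<otimes>\<^bsub>K\<^esub> d)"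
      using w'(1-3) z'(1-3) by (simp add: act_mult_right K.m_ac)
    then show ?thesis using w' z' by (simp add: df_elem_mult)
  qed
  show "df_mult \<one>\<^bsub>?EE\<^esub> = \<one>\<^bsub>D\<^esub>" by (simp add: df_one_elem)
qed

lemma df_sect_mor: "ext_mor M (terminal_ext M) (df_ext E \<gamma> D) (df_sect E \<gamma>)"
proof -
  have "(\<lambda>_. \<one>\<^bsub>K\<^esub>) \<in> mhom (singleton_group ()) K"
    by (rule mhomI) simp_all
  \<comment> \<open>The section has \<open>K\<close>-coordinate \<open>\<one>\<close>, an invertible
    element.\<close>
  moreover have "df_sect E \<gamma> m \<in> reps M (df_ext E \<gamma> D)" if "m \<in> carrier M" for m
    using that K.Units_one_closed by (auto simp: reps_def reps_at_df_ext df_sect_elem)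
  moreover have "reps M (terminal_ext M) \<subseteq> carrier M"
    by (auto simp: reps_def reps_at_def fib_def terminal_ext_def)
  moreover have "df_sect E \<gamma> (ext_inc (terminal_ext M) t) = df_inc E \<gamma> \<one>\<^bsub>K\<^esub>" for t
    by (simp add: terminal_ext_def df_sect_elem df_inc_elem)
  moreover have "ext_proj (terminal_ext M) m = m" "ext_ker (terminal_ext M) = singleton_group ()"
    "ext_mon (terminal_ext M) = M" for m
    by (simp_all add: terminal_ext_def)
  ultimately show ?thesis
    using df_sect_hom terminal_ext_obj[OF M.monoid_axioms] df_ext_obj unfolding ext_mor_def
    by (auto simp: df_sect_elem intro!: bexI[of _ "\<lambda>_. \<one>\<^bsub>K\<^esub>"])
qed

lemma df_mult_mor:
  "ext_mor M (prod_ext (df_ext E \<gamma> D) (df_ext E \<gamma> D)) (df_ext E \<gamma> D) df_mult"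
  unfolding ext_mor_def
proof (intro conjI)
  show "cc_schreier_ext M (prod_ext (df_ext E \<gamma> D) (df_ext E \<gamma> D))"
    by (intro prod_ext_obj df_ext_obj)
  show "df_mult \<in> mhom (ext_mon (prod_ext (df_ext E \<gamma> D) (df_ext E \<gamma> D))) (ext_mon (df_ext E \<gamma> D))"
    using df_mult_hom by simp
  \<comment> \<open>The kernel component is the multiplication of \<open>K\<close>, a homomorphism
    by commutativity.\<close>
  have "(\<lambda>(a, b). a \<otimes>\<^bsub>K\<^esub> b) \<in> mhom (K \<times>\<times> K) K"
    by (rule mhomI) (auto simp: K.m_ac)
  then show "\<exists>\<alpha>1 \<in> mhom (ext_ker (prod_ext (df_ext E \<gamma> D) (df_ext E \<gamma> D))) (ext_ker (df_ext E \<gamma> D)).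
      \<forall>c \<in> carrier (ext_ker (prod_ext (df_ext E \<gamma> D) (df_ext E \<gamma> D))).
        df_mult (ext_inc (prod_ext (df_ext E \<gamma> D) (df_ext E \<gamma> D)) c) = ext_inc (df_ext E \<gamma> D) (\<alpha>1 c)"
    by (intro bexI[of _ "\<lambda>(a, b). a \<otimes>\<^bsub>K\<^esub> b"]) (auto simp: df_inc_elem)
  show "\<forall>w \<in> carrier (ext_mon (prod_ext (df_ext E \<gamma> D) (df_ext E \<gamma> D))).
      ext_proj (df_ext E \<gamma> D) (df_mult w) = ext_proj (prod_ext (df_ext E \<gamma> D) (df_ext E \<gamma> D)) w"
    by (rule ballI, erule df_pair_cases) simp
  \<comment> \<open>Representatives of the product have two invertible \<open>K\<close>-coordinates,
    and a product of invertible elements is invertible.\<close>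
  show "df_mult ` reps M (prod_ext (df_ext E \<gamma> D) (df_ext E \<gamma> D)) \<subseteq> reps M (df_ext E \<gamma> D)"
    by (fastforce simp: reps_def reps_at_prod_ext reps_at_df_ext K.Units_closed)
qed (rule df_ext_obj)

text \<open>With \<open>m\<close> fixed, \<open>df_mult\<close> is the multiplication of
  \<open>K\<close> on coordinates and the section contributes \<open>\<one>\<close>, so each law is
  the corresponding law of \<open>K\<close>.\<close>

theorem df_internal_comm_monoid:
  "internal_comm_monoid M (df_ext E \<gamma> D) (df_sect E \<gamma>) df_mult"
  unfolding internal_comm_monoid_def
proof (intro conjI df_ext_obj df_sect_mor df_mult_mor)
  show "mor_eq (prod_ext (terminal_ext M) (df_ext E \<gamma> D)) (df_mult \<circ> map_prod (df_sect E \<gamma>) id) snd"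
    by (auto simp: mor_eq_def terminal_ext_def df_sect_elem elim!: df_cases)
  show "mor_eq (prod_ext (df_ext E \<gamma> D) (terminal_ext M)) (df_mult \<circ> map_prod id (df_sect E \<gamma>)) fst"
    by (auto simp: mor_eq_def terminal_ext_def df_sect_elem elim!: df_cases)
  show "mor_eq (prod_ext (prod_ext (df_ext E \<gamma> D) (df_ext E \<gamma> D)) (df_ext E \<gamma> D))
      (df_mult \<circ> map_prod df_mult id)
      (df_mult \<circ> map_prod id df_mult \<circ> (\<lambda>((x, y), z). (x, (y, z))))"
    by (auto simp: mor_eq_def K.m_assoc elim!: df_cases)
  show "mor_eq (prod_ext (df_ext E \<gamma> D) (df_ext E \<gamma> D)) (df_mult \<circ> prod.swap) df_mult"
    by (auto simp: mor_eq_def K.m_comm elim!: df_cases)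
qed

end

theorem corollary6p8:
  fixes M :: "'m monoid" and E :: "('k, 'x, 'm) mon_ext"
    and D :: "'d monoid" and \<gamma> :: "'x \<times> 'x \<Rightarrow> 'd"
  assumes "schreier_ext M E"
    and "comm_monoid_cancel (ext_ker E)"
    and "is_coequaliser (P_mon E) (R_mon E) (P_pi1 E) P_p2 \<gamma> D"
  shows "\<exists>\<mu>. internal_comm_monoid M (df_ext E \<gamma> D) (df_sect E \<gamma>) \<mu> \<and>
    (\<forall>x \<in> carrier (ext_mon E). \<forall>y \<in> carrier (ext_mon E).
     \<forall>a \<in> carrier (ext_ker E). \<forall>b \<in> carrier (ext_ker E).
       ext_proj E x = ext_proj E y \<longrightarrow>
         \<mu> (\<gamma> (x, ext_inc E a \<otimes>\<^bsub>ext_mon E\<^esub> x), \<gamma> (y, ext_inc E b \<otimes>\<^bsub>ext_mon E\<^esub> y)) =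
           \<gamma> (x, ext_inc E a \<otimes>\<^bsub>ext_mon E\<^esub> ext_inc E b \<otimes>\<^bsub>ext_mon E\<^esub> x) \<and>
         \<gamma> (x, ext_inc E a \<otimes>\<^bsub>ext_mon E\<^esub> ext_inc E b \<otimes>\<^bsub>ext_mon E\<^esub> x) =
           \<gamma> (y, ext_inc E a \<otimes>\<^bsub>ext_mon E\<^esub> ext_inc E b \<otimes>\<^bsub>ext_mon E\<^esub> y))"
proof -
  interpret cc_ext_df M E \<gamma> D
    using assms by unfold_locales (simp_all add: cc_schreier_ext_def)
  \<comment> \<open>The base point may be moved within its fibre, here with the single kernel factor
    \<open>a \<otimes> b\<close>.\<close>
  have "\<gamma> (x, k a \<otimes>\<^bsub>X\<^esub> k b \<otimes>\<^bsub>X\<^esub> x) = \<gamma> (y, k a \<otimes>\<^bsub>X\<^esub> k b \<otimes>\<^bsub>X\<^esub> y)"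
    if "x \<in> carrier X" "y \<in> carrier X" "a \<in> carrier K" "b \<in> carrier K" "f x = f y" for x y a b
    using \<gamma>_fibre[of x y "a \<otimes>\<^bsub>K\<^esub> b"] that by (simp add: k_mult)
  then show ?thesis
    by (intro exI[of _ df_mult] conjI ballI impI df_internal_comm_monoid df_mult_\<gamma>)
qed

end
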